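(* Let $B$ be a finite Blaschke product, let $R(B)$ be its Riemann surface, and let $a=0.024286\ldots$ be the constant defined in the context. Then $R(B)$ contains, up to a rotation, either the slit disk $\mathbb{D}_a$, or $\mathbb{L}_a$, or $\mathbb{L}_a^*$. Explicitly, there is a real number $\theta$ such that at least one of the following holds: (i) there is an injective holomorphic function $h:\mathbb{D}_a\to\mathbb{D}$ with $B(h(w))=e^{i\theta}w$ for all $w\in\mathbb{D}_a$; (ii) there is an injective holomorphic function $h:G_a\to\mathbb{D}$ with $B(h(w))=e^{i\theta}e^{w}$ for all $w\in G_a$; (iii) there is an injective holomorphic function $h:G_a^*\to\mathbb{D}$ with $B(h(w))=e^{i\theta}e^{w}$ for all $w\in G_a^*$.
   Context: $\mathbb{D}=\{z\in\mathbb{C}:|z|<1\}$. A finite Blaschke product is a function of the form $B(z)=\prod_{j=1}^n\frac{z-z_j}{1-\overline{z_j}z}$ with $|z_j|<1$, $n\ge 1$. A Riemann surface here means a covering (possibly ramified, not necessarily unlimited), i.e. a holomorphic map $f:D\to G$ of a Riemann surface or planar domain $D$ onto $G$ (the projection). A Riemann surface $f_2:D_2\to G_2$ contains a Riemann surface $f_1:D_1\to G_1$ if there is an injective holomorphic function $h:D_1\to D_2$ such that $f_1=f_2\circ h$. A planar domain $D$ is identified with the Riemann surface $\mathrm{id}_D:D\to D$. $R(B)$ is the Riemann surface $B:\mathbb{D}\to\mathbb{D}$. Rotating a Riemann surface $f:D\to G$ by the angle $\theta$ means replacing $f$ by $e^{i\theta}f$. The constant $a$: the equation $$s\,\frac{1-a(s)^2}{(s-a(s))^2}\,\frac{s-1}{s+1}=0.175,\qquad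 a(s):=s\,\frac{2s-(s^2-1)}{2s+(s^2-1)},$$ has a unique solution $s_0=2.379796\ldots$ in $(1,1+\sqrt2]$, and $a:=a(s_0)=0.024286\ldots$. $\mathbb{D}_a$ is the unit disk $\mathbb{D}$ with the segment $[a,1]$ of the real axis removed. $G_a$ is the union of the half-strip $S=\{w:\operatorname{Re}w<0,\ 0<\operatorname{Im}w<2\pi\}$ and the rectangle $\Pi_a=\{w:\log a<\operatorname{Re}w<0,\ 0<\operatorname{Im}w<3\pi\}$. $G_a^*$ is the reflection of $G_a$ in the real axis. With $g(w)=e^w$, $\mathbb{L}_a$ is the Riemann surface given by the non-ramified covering $g|_{G_a}:G_a\to g(G_a)$, and $\mathbb{L}_a^*$ the one given by $g|_{G_a^*}:G_a^*\to g(G_a^* )$. *)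

theory Defs
  imports "HOL-Analysis.Analysis"
begin

abbreviation unit_disk :: "complex set" where
  "unit_disk \<equiv> ball 0 1"

(* B :: complex => complex is total; only its restriction to the open unit disk matters,
   so the product formula is required there only. There is no unimodular front factor. *)
definition finite_blaschke_product :: "(complex \<Rightarrow> complex) \<Rightarrow> bool" where
  "finite_blaschke_product B \<longleftrightarrow>
     (\<exists>n z0. n \<ge> (1::nat) \<and> (\<forall>j\<in>{1..n}. cmod (z0 j) < 1) \<and>
        (\<forall>z\<in>unit_disk. B z = (\<Prod>j=1..n. (z - z0 j) / (1 - cnj (z0 j) * z))))"

(* A Riemann surface f : D -> G spread over the plane, with D a planar domain, is represented
   by its projection f and its domain D; the base G is the image f ` D. *)
definition surface_contains ::
    "(complex \<Rightarrow> complex) \<Rightarrow> complex set \<Rightarrow> (complex \<Rightarrow> complex) \<Rightarrow> complex set \<Rightarrow> bool" where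
  "surface_contains f2 D2 f1 D1 \<longleftrightarrow>
     (\<exists>h. h holomorphic_on D1 \<and> inj_on h D1 \<and> h ` D1 \<subseteq> D2 \<and> (\<forall>w\<in>D1. f2 (h w) = f1 w))"

definition rotate_surface :: "real \<Rightarrow> (complex \<Rightarrow> complex) \<Rightarrow> complex \<Rightarrow> complex" where
  "rotate_surface \<theta> f = (\<lambda>w. exp (\<i> * complex_of_real \<theta>) * f w)"

definition a_fun :: "real \<Rightarrow> real" where
  "a_fun s = s * ((2 * s - (s\<^sup>2 - 1)) / (2 * s + (s\<^sup>2 - 1)))"

(* The solution is unique: s_zero = 2.379796... and a_const = 0.024286... *)
definition s_zero :: real where
  "s_zero = (THE s. 1 < s \<and> s \<le> 1 + sqrt 2 \<and>
     s * ((1 - (a_fun s)\<^sup>2) / (s - a_fun s)\<^sup>2) * ((s - 1) / (s + 1)) = 0.175)"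

definition a_const :: real where
  "a_const = a_fun s_zero"

definition slit_disk :: "real \<Rightarrow> complex set" where
  "slit_disk a = unit_disk - closed_segment (complex_of_real a) 1"

definition G_dom :: "real \<Rightarrow> complex set" where
  "G_dom a = {w. Re w < 0 \<and> 0 < Im w \<and> Im w < 2 * pi}
           \<union> {w. ln a < Re w \<and> Re w < 0 \<and> 0 < Im w \<and> Im w < 3 * pi}"

definition G_dom_refl :: "real \<Rightarrow> complex set" where
  "G_dom_refl a = cnj ` G_dom a"

end

theory Submission
  imports Defs "HOL-Complex_Analysis.Complex_Analysis"
begin

text \<open>Let \<open>f\<close> be a Blaschke product with \<open>n\<close> factors. On the unit circle
\<open>f (cis t) = cis (Phi t)\<close> with \<open>Phi\<close> increasing and \<open>Phi (t + 2 pi) = Phi t + 2 pi n\<close>, so the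
boundary points are labelled by reals \<open>x\<close> modulo \<open>2 pi n\<close>, the point \<open>zeta x\<close> having
\<open>f (zeta x) = cis x\<close>. Following the preimage of the ray of argument \<open>x\<close> from \<open>zeta x\<close> into the
disc gives a lift \<open>H\<close> of the exponential, \<open>f (H w) = exp w\<close> and \<open>H (\<i> x) = zeta x\<close>, defined on the
closed left half-plane off the horizontal half-lines lying over critical arguments. It is
injective modulo the period \<open>2 pi \<i> n\<close>, and a domain on which it extends continuously and whose
height is at most \<open>2 pi n\<close> is embedded in the surface of \<open>f\<close> (\<open>extended_branch\<close>). All that
matters is therefore at which points, called irregular here, the limits of \<open>H\<close> from above and from
below differ.

A pair consists of two paths from one point of the disc to boundary points \<open>zeta b\<close>, \<open>zeta c\<close> with
\<open>b < c\<close> which \<open>f\<close> maps increasingly to a ray (ascents). An irregular point \<open>w\<close> yields a pair that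
starts over \<open>exp w\<close> and has different boundary points (\<open>not_reg_pair\<close>). Two pairs with interlaced ends meet, and following one to the meeting point and the other from there on produces a new pair.
Hence an irregular point over an argument strictly between \<open>b\<close> and \<open>c\<close> produces a pair with
closer ends in \<open>[b, c]\<close>, starting no lower than the lower of the two (\<open>pair_shrink\<close>). The distance
of the ends of a pair is a multiple of \<open>2 pi\<close>, so a pair with closest ends exists, and over the
arguments between its ends everything is regular, at the levels considered (\<open>minimal_pair\<close>).

Now let \<open>0 < a < 1\<close>. There are pairs starting at modulus at least \<open>a\<close>, that is at points \<open>p\<close>
with \<open>cmod (f p) \<ge> a\<close>, since \<open>0\<close> and \<open>2 pi n\<close> are labels of the same boundary point. Take one with
ends \<open>b < c\<close> in \<open>[0, 2 pi n]\<close> that is minimal among these. If \<open>c - b = 2 pi\<close>, the part of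
the disc between the two ascents is mapped by \<open>f\<close> bijectively onto a domain containing the disc
without a radial slit that starts at modulus \<open>cmod (f p)\<close> (\<open>slit_branch\<close>), so the slit disc is
contained in the surface.
Otherwise \<open>c - b \<ge> 4 pi\<close>. A pair inside \<open>[b, c]\<close> that is minimal among all pairs gives a strip of
height \<open>2 pi\<close> that is regular all the way down (\<open>regular_strip\<close>). Above or below this strip at least
\<open>pi\<close> is left of the interval \<open>(b, c)\<close>, and there everything of modulus at least \<open>a\<close> is regular;
this gives \<open>G_dom a\<close> or its reflection.

Since the argument applies to every \<open>a\<close> in \<open>(0, 1)\<close>, and the remaining real values of \<open>a\<close> follow
from the value \<open>1/2\<close> (\<open>contains_any_extend\<close>), no numerical information on \<open>a_const\<close> enters.\<close>

section \<open>Blaschke products on the closed disc\<close>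

text \<open>A single Blaschke factor.\<close>

definition bfac :: "complex \<Rightarrow> complex \<Rightarrow> complex" where
  "bfac a z = (z - a) / (1 - cnj a * z)"

lemma cmod_diff_bfac:
  "(cmod (z - a))\<^sup>2 - (cmod (1 - cnj a * z))\<^sup>2 = ((cmod z)\<^sup>2 - 1) * (1 - (cmod a)\<^sup>2)"
  unfolding cmod_power2 by (simp add: algebra_simps power2_eq_square)

lemma bfac_norm:
  assumes "cmod a < 1" "1 - cnj a * z \<noteq> 0"
  shows "cmod (bfac a z) < 1 \<longleftrightarrow> cmod z < 1" "cmod (bfac a z) \<le> 1 \<longleftrightarrow> cmod z \<le> 1"
proof -
  have p: "cmod (1 - cnj a * z) > 0" using assms by simp
  have q: "1 - (cmod a)\<^sup>2 > 0"
    using assms(1) by (simp add: power_less_one_iff abs_square_less_1)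
  have "cmod (bfac a z) < 1 \<longleftrightarrow> (cmod (z - a))\<^sup>2 < (cmod (1 - cnj a * z))\<^sup>2"
    using p power_mono_iff[of "cmod (1 - cnj a * z)" "cmod (z - a)" 2]
    by (simp add: bfac_def norm_divide not_le[symmetric])
  also have "\<dots> \<longleftrightarrow> ((cmod z)\<^sup>2 - 1) * (1 - (cmod a)\<^sup>2) < 0"
    using cmod_diff_bfac[of z a] by linarith
  also have "\<dots> \<longleftrightarrow> cmod z < 1"
    using q mult_less_0_iff[of "(cmod z)\<^sup>2 - 1" "1 - (cmod a)\<^sup>2"] abs_square_less_1[of "cmod z"]
    by (simp only: abs_norm_cancel) argo
  finally show "cmod (bfac a z) < 1 \<longleftrightarrow> cmod z < 1" .
  have "cmod (bfac a z) \<le> 1 \<longleftrightarrow> (cmod (z - a))\<^sup>2 \<le> (cmod (1 - cnj a * z))\<^sup>2"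
    using p power_mono_iff[of "cmod (z - a)" "cmod (1 - cnj a * z)" 2]
    by (simp add: bfac_def norm_divide)
  also have "\<dots> \<longleftrightarrow> ((cmod z)\<^sup>2 - 1) * (1 - (cmod a)\<^sup>2) \<le> 0"
    using cmod_diff_bfac[of z a] by linarith
  also have "\<dots> \<longleftrightarrow> cmod z \<le> 1"
    using q mult_le_0_iff[of "(cmod z)\<^sup>2 - 1" "1 - (cmod a)\<^sup>2"] abs_square_le_1[of "cmod z"]
    by (simp only: abs_norm_cancel) argo
  finally show "cmod (bfac a z) \<le> 1 \<longleftrightarrow> cmod z \<le> 1" .
qed

lemma bfac_denom_nz:
  assumes "cmod a < 1" "cmod z \<le> 1" shows "1 - cnj a * z \<noteq> 0"
proof
  assume "1 - cnj a * z = 0"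
  then have "cmod (cnj a * z) = 1" by (metis eq_iff_diff_eq_0 norm_one)
  then have "cmod a * cmod z = 1" by (simp add: norm_mult)
  moreover have "cmod a * cmod z \<le> cmod a * 1" using assms by (intro mult_left_mono) auto
  ultimately show False using assms by simp
qed

lemma strict_mono_of_inj_shift:
  fixes F :: "real \<Rightarrow> real"
  assumes "continuous_on UNIV F" "inj F" "\<And>t. F (t + 2*pi) = F t + 2*pi"
  shows "strict_mono F"
proof -
  have "strict_mono_on UNIV F \<or> strict_antimono_on UNIV F"
    using injective_eq_monotone_map[of UNIV F] assms(1,2) by (auto simp: is_interval_univ inj_on_def)
  moreover have "\<not> strict_antimono_on UNIV F"
  proof
    assume "strict_antimono_on UNIV F"
    then have "F 0 > F (0 + 2*pi)"
      by (auto simp: monotone_on_def)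
    with assms(3)[of 0] show False using pi_gt_zero by linarith
  qed
  ultimately show ?thesis by blast
qed

text \<open>A continuous branch of the argument of \<open>bfac a\<close> along the unit circle. It is explicit because
\<open>bfac a (cis t) = cis t * u / cnj u\<close> for \<open>u = 1 - a * cis (- t)\<close>, whose real part is positive.\<close>

definition bfac_arg :: "complex \<Rightarrow> real \<Rightarrow> real" where
  "bfac_arg a t = t + 2 * Arg (1 - a * cis (-t))"

lemma bfac_cis:
  assumes "cmod a < 1"
  shows "bfac a (cis t) = cis (bfac_arg a t)"
proof -
  define u where "u = 1 - a * cis (-t)"
  have "cmod (a * cis (-t)) < 1" using assms by (simp add: norm_mult)
  then have "u \<noteq> 0" unfolding u_def by (metis eq_iff_diff_eq_0 norm_one less_irrefl)
  then have u: "u = of_real (cmod u) * cis (Arg u)" "cmod u \<noteq> 0"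
    by (simp_all add: Arg_eq cis_conv_exp)
  have "cis t - a = cis t * u" by (simp add: u_def algebra_simps cis_mult)
  moreover have "1 - cnj a * cis t = cnj u" by (simp add: u_def cis_cnj)
  moreover have "u / cnj u = cis (2 * Arg u)"
  proof -
    have "cnj u = of_real (cmod u) * cis (- Arg u)"
      by (subst u(1)) (simp add: cis_cnj)
    then have "u / cnj u = (of_real (cmod u) * cis (Arg u)) / (of_real (cmod u) * cis (- Arg u))"
      using u(1) by simp
    also have "\<dots> = cis (Arg u) / cis (- Arg u)" using u(2) by simp
    finally show ?thesis by (simp add: cis_divide)
  qed
  ultimately have "bfac a (cis t) = cis t * cis (2 * Arg u)"
    by (simp only: bfac_def times_divide_eq_right[symmetric])
  then show ?thesis by (simp add: bfac_arg_def cis_mult u_def)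
qed

lemma bfac_arg:
  assumes "cmod a < 1"
  shows "strict_mono (bfac_arg a)" "continuous_on UNIV (bfac_arg a)"
    "bfac_arg a (t + 2*pi) = bfac_arg a t + 2*pi"
proof -
  have cis_per: "cis (t + 2*pi) = cis t" "cis (-t - 2*pi) = cis (-t)" for t
    by (auto simp: complex_eq_iff sin_diff cos_diff)
  have sh: "bfac_arg a (t + 2*pi) = bfac_arg a t + 2*pi" for t
    by (simp add: bfac_arg_def cis_per)
  then show "bfac_arg a (t + 2*pi) = bfac_arg a t + 2*pi" .
  have "1 - a * cis (-t) \<notin> \<real>\<^sub>\<le>\<^sub>0" for t
  proof -
    have "cmod (a * cis (-t)) < 1" using assms by (simp add: norm_mult)
    then have "Re (a * cis (-t)) < 1" using complex_Re_le_cmod order.strict_trans1 by blast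
    then have "Re (1 - a * cis (-t)) > 0" by simp
    then show ?thesis by (auto simp: complex_nonpos_Reals_iff)
  qed
  then show c: "continuous_on UNIV (bfac_arg a)"
    unfolding bfac_arg_def by (intro continuous_intros continuous_on_compose2[OF continuous_on_Arg]) auto
  have "inj (bfac_arg a)"
  proof (rule injI)
    fix s t assume st: "bfac_arg a s = bfac_arg a t"
    then have e: "bfac a (cis s) = bfac a (cis t)" using assms by (simp add: bfac_cis)
    have d: "1 - cnj a * cis s \<noteq> 0" "1 - cnj a * cis t \<noteq> 0"
      using bfac_denom_nz[OF assms] by simp_all
    have "cmod (a * cnj a) < 1"
      using assms by (simp add: norm_mult power2_eq_square[symmetric] abs_square_less_1)
    then have e': "1 - a * cnj a \<noteq> 0" by auto
    have "(cis s - a) * (1 - cnj a * cis t) = (cis t - a) * (1 - cnj a * cis s)"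
      using e d by (simp add: bfac_def frac_eq_eq)
    then have "(cis s - cis t) * (1 - a * cnj a) = 0" by (simp add: algebra_simps)
    then have "cis s = cis t" using e' by simp
    then obtain k :: int where k: "s = t + 2 * pi * k"
      using sin_cos_eq_iff[of s t] by (auto simp: complex_eq_iff)
    have step: "bfac_arg a (t + 2 * pi * real m) = bfac_arg a t + 2 * pi * real m" for t and m :: nat
    proof (induction m)
      case (Suc m)
      show ?case using sh[of "t + 2 * pi * real m"] Suc by (simp add: algebra_simps)
    qed simp
    show "s = t"
    proof (cases "k \<ge> 0")
      case True
      then have "s = t + 2 * pi * real (nat k)" using k by simp
      with step[of t "nat k"] st show ?thesis by simp
    next
      case False
      then have "t = s + 2 * pi * real (nat (-k))" using k by simp
      with step[of s "nat (-k)"] st show ?thesis by simp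
    qed
  qed
  with c sh show "strict_mono (bfac_arg a)" by (intro strict_mono_of_inj_shift)
qed

text \<open>On the circle \<open>z * f' z / f z\<close> is a positive real for each factor, hence for the product; in
particular a Blaschke product has no critical points on the circle.\<close>

lemma bfac_deriv:
  assumes "cmod a < 1" "cmod z = 1"
  shows "\<exists>D>0. (bfac a has_field_derivative (of_real D * bfac a z / z)) (at z)"
proof -
  have d: "1 - cnj a * z \<noteq> 0" using bfac_denom_nz[OF assms(1)] assms(2) by simp
  have za: "z - a \<noteq> 0" using assms by auto
  have zz: "z * cnj z = 1" using assms(2) by (simp add: complex_norm_square[symmetric])
  have dz: "1 - cnj a * z = z * cnj (z - a)" using zz by (simp add: algebra_simps)
  define D where "D = (1 - (cmod a)\<^sup>2) / (cmod (z - a))\<^sup>2"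
  have "D > 0" unfolding D_def using za assms(1)
    by (auto simp: zero_less_divide_iff abs_square_less_1)
  have "(bfac a has_field_derivative ((1 - cnj a * z) + cnj a * (z - a)) / (1 - cnj a * z)\<^sup>2) (at z)"
    unfolding bfac_def using d
    by (auto intro!: derivative_eq_intros simp: power2_eq_square)
  moreover have "((1 - cnj a * z) + cnj a * (z - a)) / (1 - cnj a * z)\<^sup>2 = of_real D * bfac a z / z"
  proof -
    have aa: "of_real ((cmod a)\<^sup>2) = a * cnj a" "of_real ((cmod (z-a))\<^sup>2) = (z-a) * cnj (z-a)"
      by (simp_all only: complex_norm_square)
    have D: "complex_of_real D = (1 - a * cnj a) / ((z-a) * cnj (z-a))"
      unfolding D_def of_real_divide of_real_diff aa by simp
    have ca: "cnj (z - a) \<noteq> 0" "z \<noteq> 0" using za dz d by auto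
    have "of_real D * bfac a z / z = (1 - a * cnj a) / (z * cnj (z-a))\<^sup>2 "
      unfolding D bfac_def dz using za ca by (simp add: power2_eq_square divide_simps del: complex_cnj_diff)
    then show ?thesis unfolding dz[symmetric] by (simp add: algebra_simps)
  qed
  ultimately show ?thesis using \<open>D > 0\<close> by auto
qed

lemma prod_bfac_deriv:
  assumes "finite A" "A \<noteq> {}" "\<And>j. j \<in> A \<Longrightarrow> cmod (c j) < 1" "cmod z = 1"
  shows "\<exists>D>0. ((\<lambda>z. \<Prod>j\<in>A. bfac (c j) z) has_field_derivative
            (of_real D * (\<Prod>j\<in>A. bfac (c j) z) / z)) (at z)"
  using assms
proof (induction A rule: finite_ne_induct)
  case (singleton x)
  then show ?case using bfac_deriv[of "c x" z] by simp
next
  case (insert x F)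
  obtain D1 where D1: "D1 > 0" "(bfac (c x) has_field_derivative (of_real D1 * bfac (c x) z / z)) (at z)"
    using bfac_deriv[of "c x" z] insert by auto
  obtain D2 where D2: "D2 > 0" "((\<lambda>z. \<Prod>j\<in>F. bfac (c j) z) has_field_derivative
            (of_real D2 * (\<Prod>j\<in>F. bfac (c j) z) / z)) (at z)"
    using insert by auto
  have "((\<lambda>z. bfac (c x) z * (\<Prod>j\<in>F. bfac (c j) z)) has_field_derivative
       (of_real (D1 + D2) * (bfac (c x) z * (\<Prod>j\<in>F. bfac (c j) z)) / z)) (at z)"
    by (rule DERIV_cong[OF DERIV_mult[OF D1(2) D2(2)]])
      (simp add: distrib_left distrib_right add_divide_distrib mult_ac)
  then show ?case using D1(1) D2(1) insert by (intro exI[of _ "D1 + D2"]) simp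
qed

lemma sum_strict_mono_fun:
  fixes F :: "'i \<Rightarrow> real \<Rightarrow> real"
  assumes "finite A" "A \<noteq> {}" "\<And>j. j \<in> A \<Longrightarrow> strict_mono (F j)"
  shows "strict_mono (\<lambda>t. \<Sum>j\<in>A. F j t)"
  using assms by (intro strict_monoI sum_strict_mono) (auto dest: strict_monoD)

lemma cis_sum: "finite A \<Longrightarrow> cis (\<Sum>j\<in>A. g j) = (\<Prod>j\<in>A. cis (g j))"
  by (induction A rule: finite_induct) (auto simp flip: cis_mult)

text \<open>What is used of a finite Blaschke product: a holomorphic map on a connected neighbourhood of the
closed disc that preserves the inside, the circle and the outside, without critical points on the
circle, and given there by an increasing lift \<open>Phi\<close> of degree \<open>n\<close>.\<close>

locale disc_map =
  fixes f :: "complex \<Rightarrow> complex" and Om :: "complex set" and Phi :: "real \<Rightarrow> real" and n :: nat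
  assumes open_Om: "open Om" and conn_Om: "connected Om" and cball_Om: "cball 0 1 \<subseteq> Om"
    and holf: "f holomorphic_on Om"
    and norm_less: "z \<in> Om \<Longrightarrow> cmod (f z) < 1 \<longleftrightarrow> cmod z < 1"
    and norm_le: "z \<in> Om \<Longrightarrow> cmod (f z) \<le> 1 \<longleftrightarrow> cmod z \<le> 1"
    and deriv_bdry: "cmod z = 1 \<Longrightarrow> deriv f z \<noteq> 0"
    and Phi: "f (cis t) = cis (Phi t)" and Phi_mono: "strict_mono Phi"
    and Phi_cont: "continuous_on UNIV Phi" and Phi_shift: "Phi (t + 2*pi) = Phi t + 2*pi*n"
    and n_pos: "n \<ge> 1"

lemma disc_map_blaschke:
  assumes n: "n \<ge> (1::nat)" and c: "\<forall>j\<in>{1..n}. cmod (c j) < 1"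
  shows "disc_map (\<lambda>z. \<Prod>j=1..n. bfac (c j) z) {z. \<forall>j\<in>{1..n}. 1 - cnj (c j) * z \<noteq> 0}
           (\<lambda>t. \<Sum>j=1..n. bfac_arg (c j) t) n"
proof
  define Om where "Om = {z. \<forall>j\<in>{1..n}. 1 - cnj (c j) * z \<noteq> 0}"
  define P where "P = (\<lambda>j. {z. 1 - cnj (c j) * z = 0})"
  have Om_eq: "Om = - (\<Union>j\<in>{1..n}. P j)" by (auto simp: Om_def P_def)
  have "finite (P j)" for j
  proof (rule finite_subset)
    show "P j \<subseteq> {1 / cnj (c j)}" by (auto simp: P_def eq_divide_eq mult.commute)
  qed simp
  then have fin: "finite (\<Union>j\<in>{1..n}. P j)" by simp
  show "open {z. \<forall>j\<in>{1..n}. 1 - cnj (c j) * z \<noteq> 0}"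
    unfolding Om_def[symmetric] Om_eq using finite_imp_closed[OF fin] by (rule open_Compl)
  show "connected {z. \<forall>j\<in>{1..n}. 1 - cnj (c j) * z \<noteq> 0}"
    unfolding Om_def[symmetric] Om_eq
    using connected_open_diff_countable[OF _ open_UNIV connected_UNIV countable_finite[OF fin]]
    by (simp add: Compl_eq_Diff_UNIV)
  show "cball 0 1 \<subseteq> {z. \<forall>j\<in>{1..n}. 1 - cnj (c j) * z \<noteq> 0}"
  proof (intro subsetI CollectI ballI)
    fix z j assume "z \<in> cball (0::complex) 1" "j \<in> {1..n}"
    then show "1 - cnj (c j) * z \<noteq> 0" using c by (intro bfac_denom_nz) auto
  qed
  show "(\<lambda>z. \<Prod>j = 1..n. bfac (c j) z) holomorphic_on {z. \<forall>j\<in>{1..n}. 1 - cnj (c j) * z \<noteq> 0}"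
    unfolding bfac_def by (intro holomorphic_intros) auto
  have lt: "cmod (\<Prod>j\<in>A. bfac (c j) z) < 1"
    if "finite A" "A \<noteq> {}" "A \<subseteq> {1..n}" "cmod z < 1" for A z
    using that
  proof (induction A rule: finite_ne_induct)
    case (singleton x)
    then show ?case using bfac_norm(1)[OF _ bfac_denom_nz] c by simp
  next
    case (insert x F)
    then have "cmod (bfac (c x) z) < 1" using bfac_norm(1)[OF _ bfac_denom_nz] c by simp
    moreover have "cmod (\<Prod>j\<in>F. bfac (c j) z) < 1" using insert by simp
    ultimately have "cmod (bfac (c x) z) * cmod (\<Prod>j\<in>F. bfac (c j) z) < 1 * 1"
      by (intro mult_strict_mono') auto
    with insert show ?case by (simp add: norm_mult)
  qed
  have eq: "cmod (\<Prod>j=1..n. bfac (c j) z) = 1" if "cmod z = 1" for z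
  proof -
    have "cmod (bfac (c j) z) = 1" if "j \<in> {1..n}" for j
    proof -
      have "1 - cnj (c j) * z \<noteq> 0" "cmod (c j) < 1" using bfac_denom_nz[of "c j" z] c that \<open>cmod z = 1\<close> by auto
      from bfac_norm[OF this(2,1)] that \<open>cmod z = 1\<close> show ?thesis by linarith
    qed
    then show ?thesis by (simp add: prod_norm[symmetric])
  qed
  have gt: "cmod (\<Prod>j\<in>A. bfac (c j) z) > 1"
    if "finite A" "A \<noteq> {}" "A \<subseteq> {1..n}" "cmod z > 1" "z \<in> Om" for A z
    using that
  proof (induction A rule: finite_ne_induct)
    case (singleton x)
    then have "x \<in> {1..n}" by simp
    then show ?case using bfac_norm(2)[of "c x" z] c singleton by (auto simp: Om_def)
  next
    case (insert x F)
    then have "x \<in> {1..n}" by simp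
    then have "cmod (bfac (c x) z) > 1" using bfac_norm(2)[of "c x" z] c insert.prems by (auto simp: Om_def)
    moreover have "cmod (\<Prod>j\<in>F. bfac (c j) z) > 1" using insert by simp
    ultimately have "cmod (bfac (c x) z) * cmod (\<Prod>j\<in>F. bfac (c j) z) > 1"
      by (rule less_1_mult)
    with insert show ?case by (simp add: norm_mult)
  qed
  have ne: "{1..n} \<noteq> {}" using n by simp
  show "cmod (\<Prod>j = 1..n. bfac (c j) z) < 1 \<longleftrightarrow> cmod z < 1"
    and "cmod (\<Prod>j = 1..n. bfac (c j) z) \<le> 1 \<longleftrightarrow> cmod z \<le> 1"
    if "z \<in> {z. \<forall>j\<in>{1..n}. 1 - cnj (c j) * z \<noteq> 0}" for z
  proof -
    have "(cmod z < 1 \<and> cmod (\<Prod>j = 1..n. bfac (c j) z) < 1)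
      \<or> (cmod z = 1 \<and> cmod (\<Prod>j = 1..n. bfac (c j) z) = 1)
      \<or> (cmod z > 1 \<and> cmod (\<Prod>j = 1..n. bfac (c j) z) > 1)"
      using lt[OF finite_atLeastAtMost ne order_refl, of z] eq[of z]
        gt[OF finite_atLeastAtMost ne order_refl, of z] that[folded Om_def]
      using linorder_less_linear[of "cmod z" 1] by argo
    then show "cmod (\<Prod>j = 1..n. bfac (c j) z) < 1 \<longleftrightarrow> cmod z < 1"
      and "cmod (\<Prod>j = 1..n. bfac (c j) z) \<le> 1 \<longleftrightarrow> cmod z \<le> 1" by linarith+
  qed
  show "deriv (\<lambda>z. \<Prod>j = 1..n. bfac (c j) z) z \<noteq> 0" if "cmod z = 1" for z
  proof -
    obtain D where "D > 0" "((\<lambda>z. \<Prod>j\<in>{1..n}. bfac (c j) z) has_field_derivative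
            (of_real D * (\<Prod>j\<in>{1..n}. bfac (c j) z) / z)) (at z)"
      using prod_bfac_deriv[of "{1..n}" c z] c ne \<open>cmod z = 1\<close> by auto
    moreover have "(\<Prod>j\<in>{1..n}. bfac (c j) z) \<noteq> 0"
    proof
      assume "(\<Prod>j\<in>{1..n}. bfac (c j) z) = 0"
      with eq[OF that] show False by (metis norm_zero zero_neq_one)
    qed
    moreover have "z \<noteq> 0" using that by auto
    ultimately show ?thesis using DERIV_imp_deriv[of "\<lambda>z. \<Prod>j\<in>{1..n}. bfac (c j) z"] by simp
  qed
  show "(\<Prod>j = 1..n. bfac (c j) (cis t)) = cis (\<Sum>j = 1..n. bfac_arg (c j) t)" for t
    using c by (simp add: cis_sum bfac_cis)
  show "strict_mono (\<lambda>t. \<Sum>j = 1..n. bfac_arg (c j) t)"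
    using c ne by (intro sum_strict_mono_fun bfac_arg) auto
  show "continuous_on UNIV (\<lambda>t. \<Sum>j = 1..n. bfac_arg (c j) t)"
    using c by (intro continuous_on_sum bfac_arg) auto
  show "(\<Sum>j = 1..n. bfac_arg (c j) (t + 2*pi)) = (\<Sum>j = 1..n. bfac_arg (c j) t) + 2*pi*n" for t
    using c by (simp add: bfac_arg sum.distrib)
  show "n \<ge> 1" by fact
qed

section \<open>A covering over the slit punctured disc\<close>

lemma sgn_exp_complex: "sgn (exp w) = cis (Im w)" for w :: complex
  by (simp add: exp_eq_polar sgn_eq norm_mult)

lemma cis_eq_cis_iff: "cis x = cis y \<longleftrightarrow> (\<exists>k::int. x = y + 2*pi*k)"
  using sin_cos_eq_iff[of x y] by (auto simp: complex_eq_iff)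

context disc_map
begin

lemma Phi_shift_int: "Phi (t + 2*pi * of_int k) = Phi t + 2*pi*n * of_int k"
proof -
  have step: "Phi (t + 2 * pi * real m) = Phi t + 2*pi*n * real m" for t and m :: nat
  proof (induction m)
    case (Suc m)
    show ?case using Phi_shift[of "t + 2 * pi * real m"] Suc by (simp add: algebra_simps)
  qed simp
  show ?thesis
  proof (cases "k \<ge> 0")
    case True
    then show ?thesis using step[of t "nat k"] by simp
  next
    case False
    then show ?thesis using step[of "t + 2*pi * of_int k" "nat (-k)"] by simp
  qed
qed

lemma surj_Phi: "surj Phi"
proof (unfold surj_def, rule allI)
  fix y
  define k where "k = \<lceil>\<bar>y - Phi 0\<bar>\<rceil>"
  have k: "\<bar>y - Phi 0\<bar> \<le> of_int k" "0 \<le> k" unfolding k_def by linarith+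
  have "of_int k * 1 \<le> of_int k * (2*pi*n)"
  proof (rule mult_left_mono)
    have "1 * 1 \<le> (2*pi) * real n"
      using n_pos pi_gt3 by (intro mult_mono) auto
    then show "1 \<le> 2*pi*n" by simp
  qed (use k in simp)
  with k have k: "\<bar>y - Phi 0\<bar> \<le> 2*pi*n * of_int k" by (simp add: mult.commute)
  have "Phi (0 + 2*pi * of_int (-k)) \<le> y" "y \<le> Phi (0 + 2*pi * of_int k)"
    unfolding Phi_shift_int using k by (auto simp: abs_le_iff)
  moreover have "2*pi * of_int (-k) \<le> 2*pi * of_int k" using \<open>0 \<le> k\<close> by simp
  ultimately have "\<exists>x\<ge>2*pi * of_int (-k). x \<le> 2*pi * of_int k \<and> Phi x = y"
    using IVT'[of Phi "2*pi * of_int (-k)" y "2*pi * of_int k"] continuous_on_subset[OF Phi_cont] by auto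
  then show "\<exists>x. y = Phi x" by blast
qed

lemma inj_Phi: "inj Phi"
  using Phi_mono strict_mono_imp_inj_on by blast

text \<open>The inverse of the boundary lift.\<close>

definition tau :: "real \<Rightarrow> real" where "tau = inv Phi"

lemma Phi_tau [simp]: "Phi (tau x) = x"
  by (simp add: tau_def surj_Phi surj_f_inv_f)

lemma tau_Phi [simp]: "tau (Phi x) = x"
  by (simp add: tau_def inj_Phi)

lemma tau_less: "tau x < tau y \<longleftrightarrow> x < y"
  by (metis Phi_mono Phi_tau strict_mono_less)

lemma tau_shift: "tau (x + 2*pi*n * of_int k) = tau x + 2*pi * of_int k"
  by (metis Phi_shift_int Phi_tau tau_Phi)

lemma tau_cont: "continuous_on UNIV tau"
proof (rule continuous_onI_mono)
  have "range tau = UNIV" by (metis surjI tau_Phi)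
  then show "open (range tau)" by simp
qed (use tau_less in \<open>auto simp: le_less\<close>)

text \<open>The boundary point with label \<open>x\<close>.\<close>

definition zeta :: "real \<Rightarrow> complex" where "zeta x = cis (tau x)"

lemma norm_zeta [simp]: "cmod (zeta x) = 1" by (simp add: zeta_def)

lemma f_zeta [simp]: "f (zeta x) = cis x" by (simp add: zeta_def Phi)

lemma zeta_cont: "continuous_on A zeta"
  unfolding zeta_def
  using continuous_on_compose2[OF continuous_on_cis[OF continuous_on_id] continuous_on_subset[OF tau_cont]]
  by (auto intro!: continuous_intros continuous_on_subset[OF tau_cont])

lemma zeta_eq_iff: "zeta x = zeta y \<longleftrightarrow> (\<exists>k::int. x = y + 2*pi*n*k)"
proof
  assume "zeta x = zeta y"
  then obtain k :: int where "tau x = tau y + 2*pi*k" by (auto simp: zeta_def cis_eq_cis_iff)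
  then have "Phi (tau x) = Phi (tau y + 2*pi*k)" by simp
  then show "\<exists>k::int. x = y + 2*pi*n*k" unfolding Phi_shift_int Phi_tau by blast
next
  assume "\<exists>k::int. x = y + 2*pi*n*k"
  then show "zeta x = zeta y" by (auto simp: zeta_def cis_eq_cis_iff tau_shift)
qed

lemma zeta_surj: "cmod z = 1 \<Longrightarrow> \<exists>x. z = zeta x"
proof -
  assume "cmod z = 1"
  then obtain t where "z = cis t" by (metis cis_Arg norm_zero zero_neq_one sgn_eq div_by_1 of_real_1)
  then have "z = zeta (Phi t)" by (simp add: zeta_def)
  then show ?thesis by blast
qed

lemma contf: "A \<subseteq> Om \<Longrightarrow> continuous_on A f"
  using holf holomorphic_on_imp_continuous_on continuous_on_subset by blast

lemma contf_cball: "continuous_on (cball 0 1) f"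
  using contf cball_Om by blast

lemma f_ball: "z \<in> ball 0 1 \<Longrightarrow> cmod (f z) < 1"
  using norm_less[of z] cball_Om by (auto dest: subsetD[where c=z])

lemma f_cball: "z \<in> cball 0 1 \<Longrightarrow> cmod (f z) \<le> 1"
  using norm_le[of z] cball_Om by (auto dest: subsetD[where c=z])

lemma f_nonconst: "\<not> f constant_on Om"
proof
  assume "f constant_on Om"
  then obtain c where c: "\<And>z. z \<in> Om \<Longrightarrow> f z = c" by (auto simp: constant_on_def)
  have "1 \<in> Om" using cball_Om by auto
  have "(f has_field_derivative 0) (at 1)"
    by (rule has_field_derivative_transform_within_open[OF DERIV_const open_Om \<open>1 \<in> Om\<close>, of c])
      (simp add: c)
  then have "deriv f 1 = 0" by (rule DERIV_imp_deriv)
  with deriv_bdry[of 1] show False by simp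
qed

lemma f_open_map: "open U \<Longrightarrow> U \<subseteq> Om \<Longrightarrow> open (f ` U)"
  by (rule open_mapping_thm[OF holf open_Om conn_Om _ _ f_nonconst])

lemma finite_fibre: "finite {z\<in>cball 0 1. f z = v}"
proof -
  have "finite {z\<in>cball 0 1. f z - v = 0}"
  proof (rule holomorphic_compact_finite_zeros[OF _ open_Om conn_Om _ cball_Om])
    show "(\<lambda>z. f z - v) holomorphic_on Om" by (intro holomorphic_intros holf)
    show "\<not> (\<lambda>z. f z - v) constant_on Om"
      using f_nonconst unfolding constant_on_def by (metis eq_diff_eq)
  qed simp
  then show ?thesis by simp
qed

lemma f_surj: "f ` cball 0 1 = cball 0 1"
proof
  show "f ` cball 0 1 \<subseteq> cball 0 1" using f_cball by auto
  define A where "A = f ` ball 0 1"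
  define B where "B = ball 0 1 - f ` cball 0 1"
  have "open A" unfolding A_def by (rule f_open_map) (use cball_Om in auto)
  have "compact (f ` cball 0 1)" by (intro compact_continuous_image contf_cball) simp
  then have "open B" unfolding B_def by (intro open_Diff compact_imp_closed) auto
  have "A \<inter> B = {}" by (auto simp: A_def B_def)
  have "A \<subseteq> ball 0 1" unfolding A_def using f_ball by auto
  have "ball 0 1 \<subseteq> A \<union> B"
  proof
    fix v assume v: "v \<in> ball (0::complex) 1"
    show "v \<in> A \<union> B"
    proof (cases "v \<in> f ` cball 0 1")
      case True
      then obtain z where "z \<in> cball 0 1" "v = f z" by auto
      then show ?thesis using norm_less[of z] v cball_Om by (auto simp: A_def)
    qed (use v in \<open>simp add: B_def\<close>)
  qed
  moreover have "f 0 \<in> A \<inter> ball 0 1" using f_ball[of 0] by (auto simp: A_def)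
  then have "A \<inter> ball 0 1 \<noteq> {}" by blast
  ultimately have "B \<inter> ball 0 1 = {}"
    using connectedD[OF connected_ball[of "0::complex" 1] \<open>open A\<close> \<open>open B\<close>] \<open>A \<inter> B = {}\<close> by blast
  then have "B = {}" by (auto simp: B_def)
  show "cball 0 1 \<subseteq> f ` cball 0 1"
  proof
    fix v assume v: "v \<in> cball (0::complex) 1"
    show "v \<in> f ` cball 0 1"
    proof (cases "cmod v = 1")
      case True
      then obtain t where "v = cis t" by (metis cis_Arg norm_zero zero_neq_one sgn_eq div_by_1 of_real_1)
      then have "v = f (zeta t)" by simp
      moreover have "zeta t \<in> cball 0 1" by simp
      ultimately show ?thesis by blast
    next
      case False
      then have "v \<in> ball 0 1" using v by simp
      then show ?thesis using \<open>B = {}\<close> by (auto simp: B_def)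
    qed
  qed
qed

text \<open>Properness: points whose image is close to \<open>v\<close> are close to the fibre over \<open>v\<close>.\<close>

lemma fibre_nbhd:
  assumes "e > 0"
  shows "\<exists>d>0. \<forall>z\<in>cball 0 1. dist (f z) v < d \<longrightarrow> (\<exists>y\<in>cball 0 1. f y = v \<and> dist z y < e)"
proof -
  define K where "K = cball 0 1 - (\<Union>y\<in>{y\<in>cball 0 1. f y = v}. ball y e)"
  have "compact K" unfolding K_def by (intro compact_diff) auto
  then have "closed (f ` K)"
    by (intro compact_imp_closed compact_continuous_image continuous_on_subset[OF contf_cball])
      (auto simp: K_def)
  moreover have "v \<notin> f ` K" using assms by (auto simp: K_def)
  ultimately obtain d where "d > 0" and d: "ball v d \<subseteq> - f ` K"
    by (metis ComplI open_Compl open_contains_ball)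
  have "\<exists>y\<in>cball 0 1. f y = v \<and> dist z y < e" if z: "z \<in> cball 0 1" "dist (f z) v < d" for z
  proof -
    have "f z \<in> ball v d" using z by (simp add: dist_commute)
    then have "z \<notin> K" using d by auto
    then show ?thesis using z by (auto simp: K_def dist_commute)
  qed
  with \<open>d > 0\<close> show ?thesis by blast
qed

text \<open>\<open>Crit\<close> are the critical points, \<open>Args\<close> the directions of the nonzero critical values, and \<open>Rad\<close>
bounds the moduli of the critical values; taking the maximum with \<open>1/2\<close> keeps \<open>Rad\<close> positive.\<close>

definition Crit :: "complex set" where "Crit = {z\<in>cball 0 1. deriv f z = 0}"

lemma finite_Crit: "finite Crit"
proof (cases "deriv f constant_on Om")
  case True
  have "deriv f z \<noteq> 0" if "z \<in> cball 0 1" for z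
  proof -
    have "z \<in> Om" "1 \<in> Om" using that cball_Om by auto
    then have "deriv f z = deriv f 1" using True unfolding constant_on_def by metis
    then show ?thesis using deriv_bdry[of 1] by simp
  qed
  then have "Crit = {}" by (auto simp: Crit_def)
  then show ?thesis by simp
next
  case False
  then show ?thesis unfolding Crit_def
    by (intro holomorphic_compact_finite_zeros[OF _ open_Om conn_Om _ cball_Om] holomorphic_deriv holf open_Om) auto
qed

lemma Crit_ball: "c \<in> Crit \<Longrightarrow> cmod c < 1"
  using deriv_bdry[of c] by (cases "cmod c = 1") (auto simp: Crit_def)

definition Args :: "complex set" where "Args = (\<lambda>c. sgn (f c)) ` {c\<in>Crit. f c \<noteq> 0}"

definition Rad :: real where "Rad = Max (insert (1/2) ((\<lambda>c. cmod (f c)) ` Crit))"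

lemma finite_Args: "finite Args" by (simp add: Args_def finite_Crit)

lemma Rad: "0 < Rad" "Rad < 1" "c \<in> Crit \<Longrightarrow> cmod (f c) \<le> Rad"
proof -
  have fin: "finite (insert (1/2) ((\<lambda>c. cmod (f c)) ` Crit))" using finite_Crit by simp
  have "1/2 \<le> Rad" unfolding Rad_def by (rule Max_ge[OF fin]) simp
  then show "0 < Rad" by simp
  show "c \<in> Crit \<Longrightarrow> cmod (f c) \<le> Rad" unfolding Rad_def by (rule Max_ge[OF fin]) simp
  show "Rad < 1" unfolding Rad_def using Crit_ball f_ball by (subst Max_less_iff[OF fin]) auto
qed

text \<open>The closed punctured disc without its critical rays up to modulus \<open>Rad\<close> is \<open>base\<close>, its preimage
under \<open>f\<close> is \<open>cover\<close>, and its preimage under the exponential is \<open>comb\<close>: the closed left half-plane without finitely many (modulo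
\<open>2 pi \<i>\<close>) horizontal half-lines. Keeping the collar near the imaginary axis makes \<open>comb\<close>
simply connected, so that one lift serves all arguments.\<close>

definition comb :: "complex set" where
  "comb = {w. Re w \<le> 0 \<and> (cis (Im w) \<notin> Args \<or> ln Rad < Re w)}"

definition base :: "complex set" where
  "base = {v. v \<noteq> 0 \<and> cmod v \<le> 1 \<and> (sgn v \<notin> Args \<or> Rad < cmod v)}"

definition cover :: "complex set" where "cover = {z\<in>cball 0 1. f z \<in> base}"

lemma exp_base: "exp w \<in> base \<longleftrightarrow> w \<in> comb"
proof -
  have "Rad < exp (Re w) \<longleftrightarrow> ln Rad < Re w"
    using Rad by (metis exp_less_cancel_iff exp_ln)
  then show ?thesis by (auto simp: base_def comb_def sgn_exp_complex)
qed

lemma cover_noncrit: "z \<in> cover \<Longrightarrow> deriv f z \<noteq> 0"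
proof
  assume z: "z \<in> cover" "deriv f z = 0"
  then have "z \<in> Crit" by (auto simp: cover_def Crit_def)
  moreover have "f z \<noteq> 0" using z by (simp add: cover_def base_def)
  ultimately have "sgn (f z) \<in> Args" "cmod (f z) \<le> Rad" using Rad by (auto simp: Args_def)
  then show False using z by (auto simp: cover_def base_def)
qed

lemma covering: "covering_space cover f base"
  unfolding covering_space_def
proof (intro conjI ballI)
  show cc: "continuous_on cover f"
    by (rule continuous_on_subset[OF contf_cball]) (auto simp: cover_def)
  show "f ` cover = base"
  proof
    show "base \<subseteq> f ` cover"
    proof
      fix v assume v: "v \<in> base"
      then have "v \<in> cball 0 1" by (simp add: base_def)
      then obtain z where "z \<in> cball 0 1" "v = f z" using f_surj by blast
      with v show "v \<in> f ` cover" by (auto simp: cover_def)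
    qed
  qed (auto simp: cover_def)
  fix v assume v: "v \<in> base"
  define F where "F = {z\<in>cball 0 1. f z = v}"
  have finF: "finite F" unfolding F_def by (rule finite_fibre)
  have FC: "z \<in> cover" "f z = v" if "z \<in> F" for z using that v by (auto simp: F_def cover_def)
  have loc: "\<exists>r>0. ball z r \<subseteq> Om \<and> inj_on f (ball z r)" if "z \<in> F" for z
  proof -
    have "z \<in> Om" using that cball_Om by (auto simp: F_def)
    from has_complex_derivative_locally_injective[OF holf this open_Om cover_noncrit[OF FC(1)[OF that]]]
    show ?thesis by metis
  qed
  have "\<forall>\<^sub>F r in at_right 0. \<forall>z\<in>F. ball z r \<subseteq> Om \<and> inj_on f (ball z r)"
  proof (rule eventually_ball_finite[OF finF], rule ballI)
    fix z assume "z \<in> F"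
    then obtain r where "r > 0" "ball z r \<subseteq> Om" "inj_on f (ball z r)" using loc by blast
    then show "\<forall>\<^sub>F r in at_right 0. ball z r \<subseteq> Om \<and> inj_on f (ball z r)"
      unfolding eventually_at_right_field
      by (intro exI[of _ r]) (auto intro: inj_on_subset dest: subset_ball[OF less_imp_le])
  qed
  moreover have "\<forall>\<^sub>F r in at_right 0. \<forall>z\<in>F. \<forall>y\<in>F. z \<noteq> y \<longrightarrow> 2 * r < dist z y"
  proof (intro eventually_ball_finite[OF finF] ballI)
    fix z y
    show "\<forall>\<^sub>F r in at_right 0. z \<noteq> y \<longrightarrow> 2 * r < dist z y"
      unfolding eventually_at_right_field
      by (cases "z = y") (auto intro!: exI[of _ "if z = y then 1 else dist z y / 2"])
  qed
  moreover have "\<forall>\<^sub>F r in at_right (0::real). r > 0" by (simp add: eventually_at_right_less)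
  ultimately have "\<forall>\<^sub>F r in at_right 0. (\<forall>z\<in>F. ball z r \<subseteq> Om \<and> inj_on f (ball z r)) \<and>
      (\<forall>z\<in>F. \<forall>y\<in>F. z \<noteq> y \<longrightarrow> 2 * r < dist z y) \<and> r > 0" by eventually_elim auto
  then obtain r where r: "\<And>z. z \<in> F \<Longrightarrow> ball z r \<subseteq> Om" "\<And>z. z \<in> F \<Longrightarrow> inj_on f (ball z r)"
    "\<And>z y. z \<in> F \<Longrightarrow> y \<in> F \<Longrightarrow> z \<noteq> y \<Longrightarrow> 2 * r < dist z y" "r > 0"
    using eventually_happens'[OF trivial_limit_at_right_real] by blast
  obtain d1 where d1: "d1 > 0" "\<And>z. z \<in> cball 0 1 \<Longrightarrow> dist (f z) v < d1 \<Longrightarrow> \<exists>y\<in>F. dist z y < r"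
    using fibre_nbhd[OF \<open>r > 0\<close>, of v] unfolding F_def by blast
  have "open (\<Inter>z\<in>F. f ` ball z r)"
    by (intro open_INT finF ballI f_open_map open_ball r(1))
  moreover have "v \<in> (\<Inter>z\<in>F. f ` ball z r)"
    using FC \<open>r > 0\<close> by (auto intro!: image_eqI[of v f])
  ultimately obtain d2 where d2: "d2 > 0" "ball v d2 \<subseteq> (\<Inter>z\<in>F. f ` ball z r)"
    by (meson open_contains_ball)
  define T where "T = base \<inter> ball v (min d1 d2)"
  have T: "openin (top_of_set base) T" unfolding T_def by (rule openin_open_Int) simp
  have oT: "openin (top_of_set cover) (cover \<inter> f -` T)"
    by (rule continuous_openin_preimage[OF cc _ T]) (auto simp: cover_def)
  define sh where "sh z = ball z r \<inter> (cover \<inter> f -` T)" for z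
  \<comment> \<open>the sheets over T are the parts of small balls about the points of the fibre\<close>
  show "\<exists>T. v \<in> T \<and> openin (top_of_set base) T \<and>
        (\<exists>V. \<Union>V = cover \<inter> f -` T \<and> (\<forall>u\<in>V. openin (top_of_set cover) u) \<and>
            pairwise disjnt V \<and> (\<forall>u\<in>V. \<exists>q. homeomorphism u T f q))"
  proof (rule exI[of _ T], intro conjI, goal_cases)
    case 3
    show ?case
    proof (rule exI[of _ "sh ` F"], intro conjI ballI)
      show "\<Union>(sh ` F) = cover \<inter> f -` T"
      proof
        show "cover \<inter> f -` T \<subseteq> \<Union>(sh ` F)"
        proof
          fix z assume z: "z \<in> cover \<inter> f -` T"
          then have "dist (f z) v < d1" "z \<in> cball 0 1" by (auto simp: T_def dist_commute cover_def)
          then obtain y where "y \<in> F" "dist z y < r" using d1 by blast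
          then show "z \<in> \<Union>(sh ` F)" using z by (auto simp: sh_def dist_commute)
        qed
      qed (auto simp: sh_def)
      show "openin (top_of_set cover) u" if "u \<in> sh ` F" for u
        using that oT by (auto simp: sh_def intro!: openin_Int_open simp: Int_commute[of "ball _ _"])
      show "pairwise disjnt (sh ` F)"
      proof (rule pairwise_imageI)
        fix x y assume xy: "x \<in> F" "y \<in> F" "x \<noteq> y"
        have "ball x r \<inter> ball y r = {}"
          by (rule disjoint_ballI) (use r(3)[OF xy] in simp)
        then show "disjnt (sh x) (sh y)" by (auto simp: sh_def disjnt_def)
      qed
      fix u assume "u \<in> sh ` F"
      then obtain z where z: "z \<in> F" "u = sh z" by blast
      obtain g where g: "g holomorphic_on (f ` ball z r)" "\<And>x. x \<in> ball z r \<Longrightarrow> g (f x) = x"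
        using holomorphic_has_inverse[OF holomorphic_on_subset[OF holf r(1)[OF z(1)]] open_ball r(2)[OF z(1)]]
        by metis
      have im: "\<exists>x\<in>u. f x = t" if "t \<in> T" for t
      proof -
        have "t \<in> f ` ball z r" using that d2 z(1) by (auto simp: T_def)
        then obtain x where x: "x \<in> ball z r" "t = f x" by blast
        moreover have "cmod t \<le> 1" using that by (auto simp: T_def base_def)
        ultimately have "x \<in> cball 0 1" using norm_le[of x] r(1)[OF z(1)] by auto
        then show ?thesis using x that by (auto simp: z sh_def cover_def T_def)
      qed
      show "\<exists>q. homeomorphism u T f q"
      proof (rule exI[of _ g], unfold homeomorphism_def, intro conjI)
        show "\<forall>x\<in>u. g (f x) = x" using g by (auto simp: z sh_def)
        show fu: "f ` u = T" using im by (force simp: z sh_def)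
        show "continuous_on u f" by (rule continuous_on_subset[OF cc]) (auto simp: z sh_def)
        show "\<forall>y\<in>T. f (g y) = y" unfolding fu[symmetric] using g by (auto simp: z sh_def)
        show "g ` T = u" unfolding fu[symmetric] using g by (force simp: z sh_def image_iff)
        show "continuous_on T g"
          by (rule continuous_on_subset[OF holomorphic_on_imp_continuous_on[OF g(1)]])
            (use d2 z(1) in \<open>auto simp: T_def\<close>)
      qed
    qed
  qed (use v d1 d2 T in \<open>auto simp: T_def\<close>)
qed

lemma comb_lpc: "locally path_connected comb"
proof -
  have "open {w::complex. cis (Im w) \<notin> Args \<or> ln Rad < Re w}"
  proof -
    have "{w::complex. cis (Im w) \<notin> Args \<or> ln Rad < Re w} = ((\<lambda>w. cis (Im w)) -` (- Args)) \<union> {w. ln Rad < Re w}"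
      by auto
    moreover have "open ((\<lambda>w. cis (Im w)) -` (- Args))"
      by (intro open_vimage open_Compl finite_imp_closed finite_Args) (intro continuous_intros)
    ultimately show ?thesis by (auto intro!: open_Un open_halfspace_Re_gt)
  qed
  moreover have "comb = {w. Re w \<le> 0} \<inter> {w. cis (Im w) \<notin> Args \<or> ln Rad < Re w}"
    by (auto simp: comb_def)
  ultimately have "openin (top_of_set {w. Re w \<le> 0}) comb" by (simp add: openin_open_Int)
  moreover have "locally path_connected {w. Re w \<le> 0}"
    by (intro convex_imp_locally_path_connected convex_halfspace_Re_le)
  ultimately show ?thesis by (metis locally_open_subset)
qed

text \<open>The comb is pushed horizontally to a vertical line and then along this line to a point.\<close>

lemma comb_sc: "simply_connected comb"
proof (rule contractible_imp_simply_connected)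
  define x0 where "x0 = ln Rad / 2"
  have lr: "ln Rad < 0" using Rad by simp
  have x0: "ln Rad < x0" "x0 < 0" using lr by (auto simp: x0_def)
  have "homotopic_with_canon (\<lambda>z. True) comb comb id (\<lambda>w. Complex x0 (Im w))"
  proof (rule homotopic_with_linear)
    show "continuous_on comb (\<lambda>w. Complex x0 (Im w))" by (intro continuous_intros)
    fix w assume w: "w \<in> comb"
    show "closed_segment (id w) (Complex x0 (Im w)) \<subseteq> comb"
    proof
      fix y assume "y \<in> closed_segment (id w) (Complex x0 (Im w))"
      then obtain u where u: "0 \<le> u" "u \<le> 1" "y = (1 - u) *\<^sub>R w + u *\<^sub>R Complex x0 (Im w)"
        by (auto simp: closed_segment_def)
      have im: "Im y = Im w" by (simp add: u algebra_simps)
      have re: "Re y = (1 - u) * Re w + u * x0" by (simp add: u)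
      have "Re w \<le> 0" using w by (simp add: comb_def)
      have "(1 - u) * Re w + u * x0 \<le> 0"
        using u x0 \<open>Re w \<le> 0\<close> by (simp add: add_nonpos_nonpos mult_nonneg_nonpos)
      moreover have "ln Rad < (1 - u) * Re w + u * x0" if "ln Rad < Re w"
        using convex_bound_lt[of "- Re w" "- ln Rad" "- x0" "1-u" u] that x0 u by simp
      ultimately show "y \<in> comb" using w by (auto simp: comb_def im re)
    qed
  qed simp
  moreover have "homotopic_with_canon (\<lambda>z. True) comb comb (\<lambda>w. Complex x0 (Im w)) (\<lambda>w. Complex x0 0)"
  proof (rule homotopic_with_linear)
    show "continuous_on comb (\<lambda>w. Complex x0 (Im w))" by (intro continuous_intros)
    fix w assume w: "w \<in> comb"
    show "closed_segment (Complex x0 (Im w)) (Complex x0 0) \<subseteq> comb"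
    proof
      fix y assume "y \<in> closed_segment (Complex x0 (Im w)) (Complex x0 0)"
      then obtain u where u: "0 \<le> u" "u \<le> 1" "y = (1 - u) *\<^sub>R Complex x0 (Im w) + u *\<^sub>R Complex x0 0"
        by (auto simp: closed_segment_def)
      have "Re y = x0" by (simp add: u algebra_simps)
      then show "y \<in> comb" using x0 by (auto simp: comb_def)
    qed
  qed simp
  ultimately show "contractible comb"
    unfolding contractible_def by (meson homotopic_with_trans)
qed

end

section \<open>The lift of the exponential and its one-sided limits\<close>

lemma finite_cis_avoid:
  assumes fin: "finite F"
  shows "\<exists>d>0. \<forall>y. y \<noteq> x \<and> dist y x < d \<longrightarrow> cis y \<notin> F"
proof -
  have "\<forall>\<^sub>F y in at x. \<forall>a\<in>F. cis y \<noteq> a"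
  proof (intro eventually_ball_finite fin ballI)
    fix a
    show "\<forall>\<^sub>F y in at x. cis y \<noteq> a"
    proof (cases "cis x = a")
      case False
      have "(cis \<longlongrightarrow> cis x) (at x)" by (intro tendsto_intros)
      then show ?thesis using False tendsto_imp_eventually_ne by blast
    next
      case True
      have "y = x" if "dist y x < 2*pi" "cis y = a" for y
      proof -
        have "cis y = cis x" using that True by simp
        then obtain k :: int where k: "y = x + 2*pi*k" unfolding cis_eq_cis_iff by blast
        then have "2*pi * \<bar>real_of_int k\<bar> < 2*pi" using that by (simp add: dist_real_def abs_mult)
        then have "\<bar>real_of_int k\<bar> < 1" using pi_gt_zero by (metis mult.right_neutral mult_less_cancel_left_pos mult_pos_pos zero_less_numeral)
        then have "k = 0" by linarith
        then show ?thesis using k by simp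
      qed
      then show ?thesis unfolding eventually_at using pi_gt_zero
        by (intro exI[of _ "2*pi"]) auto
    qed
  qed
  then show ?thesis unfolding eventually_at by auto
qed

context disc_map
begin

lemma lift_unique:
  fixes g1 g2 :: "'b::topological_space \<Rightarrow> complex"
  assumes "connected T" "continuous_on T g1" "continuous_on T g2"
    "\<And>x. x \<in> T \<Longrightarrow> g1 x \<in> cover" "\<And>x. x \<in> T \<Longrightarrow> g2 x \<in> cover"
    "\<And>x. x \<in> T \<Longrightarrow> f (g1 x) = f (g2 x)" "a \<in> T" "g1 a = g2 a" "x \<in> T"
  shows "g1 x = g2 x"
proof (rule covering_space_lift_unique[OF covering, of g1 a g2 T "\<lambda>x. f (g1 x)" x])
  show "continuous_on T (\<lambda>x. f (g1 x))"
    by (rule continuous_on_compose2[OF contf_cball assms(2)]) (use assms(4) in \<open>auto simp: cover_def\<close>)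
  show "(\<lambda>x. f (g1 x)) \<in> T \<rightarrow> base" using assms(4) by (auto simp: cover_def)
qed (use assms in auto)

lemma in_cover: "z \<in> cball 0 1 \<Longrightarrow> f z = exp w \<Longrightarrow> w \<in> comb \<Longrightarrow> z \<in> cover"
  by (simp add: cover_def exp_base)

lemma comb_imag: "Complex 0 x \<in> comb"
  using Rad by (simp add: comb_def)

lemma comb_up: "Complex r x \<in> comb \<Longrightarrow> r \<le> t \<Longrightarrow> t \<le> 0 \<Longrightarrow> Complex t x \<in> comb"
  by (auto simp: comb_def)

lemma exp_Complex_im: "exp (Complex 0 x) = cis x"
  by (simp add: exp_eq_polar)

lemma exp_Complex_cong: "cis x = cis y \<Longrightarrow> exp (Complex t x) = exp (Complex t y)"
  by (simp add: exp_eq_polar)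

text \<open>The lift of the exponential through \<open>f\<close> that sends \<open>0\<close> to \<open>zeta 0\<close>.\<close>

definition H :: "complex \<Rightarrow> complex" where
  "H = (SOME H. continuous_on comb H \<and> (\<forall>w\<in>comb. H w \<in> cover \<and> f (H w) = exp w) \<and> H 0 = zeta 0)"

lemma H_ex: "\<exists>H. continuous_on comb H \<and> (\<forall>w\<in>comb. H w \<in> cover \<and> f (H w) = exp w) \<and> H 0 = zeta 0"
proof -
  have 0: "0 \<in> comb" using comb_imag[of 0] by (simp add: zero_complex.code)
  have "zeta 0 \<in> cover" by (rule in_cover[of _ 0]) (use 0 in \<open>auto\<close>)
  then obtain g where "continuous_on comb g" "g \<in> comb \<rightarrow> cover" "g 0 = zeta 0"
      "\<And>y. y \<in> comb \<Longrightarrow> f (g y) = exp y"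
    using covering_space_lift_strong[OF covering _ 0 comb_sc comb_lpc, of "zeta 0" exp]
    by (auto simp: exp_base continuous_on_exp)
  then show ?thesis by blast
qed

lemma H_cont: "continuous_on comb H" and H_cover: "w \<in> comb \<Longrightarrow> H w \<in> cover"
  and f_H: "w \<in> comb \<Longrightarrow> f (H w) = exp w" and H_0: "H 0 = zeta 0"
  using someI_ex[OF H_ex, folded H_def] by auto

lemma H_cball: "w \<in> comb \<Longrightarrow> H w \<in> cball 0 1"
  using H_cover by (auto simp: cover_def)

lemma H_imag: "H (Complex 0 x) = zeta x"
proof (rule lift_unique[of UNIV "\<lambda>x. H (Complex 0 x)" zeta 0 x])
  show "continuous_on UNIV (\<lambda>x. H (Complex 0 x))"
    by (rule continuous_on_compose2[OF H_cont]) (auto intro!: continuous_intros comb_imag)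
  show "zeta y \<in> cover" for y
    by (rule in_cover[OF _ _ comb_imag[of y]]) (simp_all add: exp_Complex_im)
  have "Complex 0 0 = 0" by (simp add: complex_eq_iff)
  then show "H (Complex 0 0) = zeta 0" using H_0 by simp
  show "f (H (Complex 0 y)) = f (zeta y)" for y
    using f_H[OF comb_imag] by (simp add: exp_Complex_im)
qed (auto simp: H_cover comb_imag zeta_cont)

lemma H_line_cont: "Complex r x \<in> comb \<Longrightarrow> continuous_on {r..0} (\<lambda>t. H (Complex t x))"
  by (rule continuous_on_compose2[OF H_cont], intro continuous_intros) (auto intro: comb_up[of r])

lemma cis_period: "cis (x + 2 * pi * of_int k) = cis x"
  using cis_eq_cis_iff[of "x + 2 * pi * of_int k" x] by auto

lemma cis_period_n: "cis (x + 2 * pi * real n * of_int k) = cis x"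
  using cis_period[of x "int n * k"] by (simp add: algebra_simps)

lemma comb_shift: "w + Complex 0 (2*pi* of_int k) \<in> comb \<longleftrightarrow> w \<in> comb"
  by (simp add: comb_def cis_period)

lemma comb_shift_n: "w + Complex 0 (2*pi * n * of_int k) \<in> comb \<longleftrightarrow> w \<in> comb"
  by (simp add: comb_def cis_period_n)

lemma exp_shift_n: "exp (w + Complex 0 (2*pi * n * of_int k)) = exp w"
  by (simp add: exp_eq_polar cis_period_n)

lemma H_period: "w \<in> comb \<Longrightarrow> H (w + Complex 0 (2*pi * n * of_int k)) = H w"
proof (rule lift_unique[of comb "\<lambda>w. H (w + Complex 0 (2*pi * n * of_int k))" H 0 w])
  show "connected comb" using comb_sc simply_connected_imp_connected by blast
  show "continuous_on comb (\<lambda>w. H (w + Complex 0 (2*pi * n * of_int k)))"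
    by (rule continuous_on_compose2[OF H_cont]) (auto intro!: continuous_intros simp: comb_shift_n)
  show "0 \<in> comb" using comb_imag[of 0] by (simp add: zero_complex.code)
  show "H (0 + Complex 0 (2*pi * n * of_int k)) = H 0"
    by (simp add: H_imag H_0 zeta_eq_iff)
qed (auto simp: H_cover comb_shift_n f_H exp_shift_n H_cont)

lemma H_eqD:
  assumes "w \<in> comb" "w' \<in> comb" "H w = H w'"
  shows "\<exists>k::int. w = w' + Complex 0 (2*pi * n * of_int k)"
proof -
  have e: "exp w = exp w'" using assms f_H by metis
  then have re: "Re w = Re w'" by (metis exp_le_cancel_iff norm_exp_eq_Re order_antisym order_refl)
  have im: "cis (Im w) = cis (Im w')" using e by (metis sgn_exp_complex)
  have w: "w = Complex (Re w) (Im w)" "w' = Complex (Re w) (Im w')" using re by (auto simp: complex_eq_iff)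
  have c: "Complex (Re w) (Im w) \<in> comb" "Complex (Re w) (Im w') \<in> comb" using w assms by auto
  have "Re w \<le> 0" using assms(1) by (simp add: comb_def)
  have "H (Complex 0 (Im w)) = H (Complex 0 (Im w'))"
  proof (rule lift_unique[of "{Re w..0}" "\<lambda>t. H (Complex t (Im w))" "\<lambda>t. H (Complex t (Im w'))" "Re w" 0])
    show "H (Complex (Re w) (Im w)) = H (Complex (Re w) (Im w'))" using assms(3) w by simp
    show "f (H (Complex t (Im w))) = f (H (Complex t (Im w')))" if "t \<in> {Re w..0}" for t
      using that c by (simp add: f_H comb_up[of "Re w"] exp_Complex_cong[OF im])
    show "H (Complex t (Im w)) \<in> cover" "H (Complex t (Im w')) \<in> cover" if "t \<in> {Re w..0}" for t
      using that c by (auto intro!: H_cover intro: comb_up[of "Re w"])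
  qed (use \<open>Re w \<le> 0\<close> H_line_cont[OF c(1)] H_line_cont[OF c(2)] in simp_all)
  then have "zeta (Im w) = zeta (Im w')" by (simp add: H_imag)
  then obtain k :: int where "Im w = Im w' + 2*pi * n *k" by (auto simp: zeta_eq_iff)
  then show ?thesis using re by (intro exI[of _ k]) (simp add: complex_eq_iff)
qed

lemma f_bdry: "z \<in> cball 0 1 \<Longrightarrow> cmod (f z) = 1 \<Longrightarrow> cmod z = 1"
  using norm_less[of z] cball_Om by (cases "cmod z = 1") (auto dest: subsetD[where c=z])

text \<open>Every point over the comb is reached by \<open>H\<close>: its ray is lifted outwards to the circle, and the
end point determines the sheet.\<close>

lemma H_onto:
  assumes z: "z \<in> cball 0 1" "f z = exp w" "w \<in> comb"
  shows "\<exists>k::int. z = H (w + Complex 0 (2*pi* of_int k))"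
proof -
  have r: "Re w \<le> 0" using z by (simp add: comb_def)
  have w: "w = Complex (Re w) (Im w)" by simp
  have c: "Complex t (Im w) \<in> comb" if "t \<in> {Re w..0}" for t
    using comb_up[of "Re w" "Im w" t] that z(3) w by auto
  obtain g where g: "continuous_on {Re w..0} g" "g \<in> {Re w..0} \<rightarrow> cover" "g (Re w) = z"
    "\<And>t. t \<in> {Re w..0} \<Longrightarrow> f (g t) = exp (Complex t (Im w))"
  proof (rule covering_space_lift_strong[OF covering, of z "Re w" "{Re w..0}" "\<lambda>t. exp (Complex t (Im w))"])
    show "z \<in> cover" by (rule in_cover[OF z])
    show "simply_connected {Re w..0}" by (intro convex_imp_simply_connected convex_real_interval)
    show "locally path_connected {Re w..0}" by (intro convex_imp_locally_path_connected convex_real_interval)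
    show "continuous_on {Re w..0} (\<lambda>t. exp (Complex t (Im w)))" by (intro continuous_intros)
  qed (use r c z w in \<open>auto simp: exp_base\<close>)
  have "g 0 \<in> cball 0 1" "f (g 0) = cis (Im w)" using g(2,4) r by (auto simp: cover_def exp_Complex_im)
  then have "cmod (g 0) = 1" by (intro f_bdry[of "g 0"]) auto
  then obtain x where x: "g 0 = zeta x" using zeta_surj by blast
  then have "cis x = cis (Im w)" using \<open>f (g 0) = cis (Im w)\<close> by simp
  then obtain k :: int where k: "x = Im w + 2*pi*k" by (auto simp: cis_eq_cis_iff)
  have c': "Complex t x \<in> comb" if "t \<in> {Re w..0}" for t
    using c[OF that] \<open>cis x = cis (Im w)\<close> by (simp add: comb_def)
  have "g (Re w) = H (Complex (Re w) x)"
  proof (rule lift_unique[of "{Re w..0}" g "\<lambda>t. H (Complex t x)" 0 "Re w"])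
    show "f (g t) = f (H (Complex t x))" if "t \<in> {Re w..0}" for t
      using g(4)[OF that] f_H[OF c'[OF that]] exp_Complex_cong[OF \<open>cis x = cis (Im w)\<close>] by simp
    show "continuous_on {Re w..0} (\<lambda>t. H (Complex t x))" using H_line_cont[OF c'] r by auto
    show "g 0 = H (Complex 0 x)" by (simp add: x H_imag)
  qed (use r g c' in \<open>auto intro!: H_cover\<close>)
  moreover have "Complex (Re w) x = w + Complex 0 (2*pi* of_int k)" by (simp add: complex_eq_iff k)
  ultimately show ?thesis using g(3) by metis
qed

text \<open>\<open>Gen\<close> is the part of the closed left half-plane over noncritical arguments, \<open>side 1 x\<close> and
\<open>side (-1) x\<close> are its parts above and below the line \<open>Im w = x\<close>.\<close>

definition Gen :: "complex set" where "Gen = {w. Re w \<le> 0 \<and> cis (Im w) \<notin> Args}"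

definition side :: "real \<Rightarrow> real \<Rightarrow> complex set" where
  "side s x = {w\<in>Gen. 0 < s * (Im w - x)}"

lemma Gen_comb: "w \<in> Gen \<Longrightarrow> w \<in> comb" by (simp add: Gen_def comb_def)

lemma side_Gen: "side s x \<subseteq> Gen" by (auto simp: side_def)

lemmas Args_discrete = finite_cis_avoid[OF finite_Args]

lemma lim_nontrivial: "Re w \<le> 0 \<Longrightarrow> s = 1 \<or> s = -1 \<Longrightarrow> at w within side s (Im w) \<noteq> bot"
proof -
  assume a: "Re w \<le> 0" "s = 1 \<or> s = -1"
  obtain d where d: "d > 0" "\<And>y. y \<noteq> Im w \<Longrightarrow> dist y (Im w) < d \<Longrightarrow> cis y \<notin> Args"
    using Args_discrete by blast
  have "\<exists>x'\<in>side s (Im w). x' \<noteq> w \<and> dist x' w < e" if "e > 0" for e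
  proof -
    define t where "t = min d e / 2"
    have t: "0 < t" "t < d" "t < e" using d(1) that by (auto simp: t_def)
    have "dist (w + Complex 0 (s * t)) w < e"
      using t a(2) by (auto simp: dist_norm cmod_def)
    moreover have "w + Complex 0 (s * t) \<noteq> w" using t a(2) by (auto simp: complex_eq_iff)
    moreover have "w + Complex 0 (s * t) \<in> side s (Im w)"
      using t a d(2)[of "Im w + s * t"] by (auto simp: side_def Gen_def dist_real_def)
    ultimately show ?thesis by blast
  qed
  then show ?thesis by (simp add: trivial_limit_within islimpt_approachable)
qed

text \<open>The values of \<open>H\<close> near \<open>w\<close> are close to the finite fibre over \<open>exp w\<close>; if the approach set is
locally connected at \<open>w\<close>, they stay close to one point of it.\<close>

lemma connected_small_limit:
  assumes A: "A \<subseteq> comb" and w: "Re w \<le> 0" and d: "d > 0" and nt: "at w within A \<noteq> bot"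
    and conn: "\<And>e. 0 < e \<Longrightarrow> e \<le> d \<Longrightarrow> connected (A \<inter> ball w e)"
  shows "\<exists>l\<in>cball 0 1. f l = exp w \<and> (H \<longlongrightarrow> l) (at w within A)"
proof -
  define F where "F = {y\<in>cball 0 1. f y = exp w}"
  have finF: "finite F" unfolding F_def by (rule finite_fibre)
  have "\<forall>\<^sub>F r in at_right 0. \<forall>z\<in>F. \<forall>y\<in>F. z \<noteq> y \<longrightarrow> 2 * r < dist z y"
  proof (intro eventually_ball_finite[OF finF] ballI)
    fix z y
    show "\<forall>\<^sub>F r in at_right 0. z \<noteq> y \<longrightarrow> 2 * r < dist z y"
      unfolding eventually_at_right_field
      by (cases "z = y") (auto intro!: exI[of _ "if z = y then 1 else dist z y / 2"])
  qed
  moreover have "\<forall>\<^sub>F r in at_right (0::real). r > 0" by (simp add: eventually_at_right_less)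
  ultimately have "\<forall>\<^sub>F r in at_right 0. (\<forall>z\<in>F. \<forall>y\<in>F. z \<noteq> y \<longrightarrow> 2 * r < dist z y) \<and> r > 0"
    by eventually_elim auto
  then obtain r where r: "\<And>z y. z \<in> F \<Longrightarrow> y \<in> F \<Longrightarrow> z \<noteq> y \<Longrightarrow> 2 * r < dist z y" "r > 0"
    using eventually_happens'[OF trivial_limit_at_right_real] by blast
  have near: "\<exists>e>0. \<forall>w'\<in>A. dist w' w < e \<longrightarrow> (\<exists>y\<in>F. dist (H w') y < e')" if e': "e' > 0" for e'
  proof -
    obtain \<delta> where dl: "\<delta> > 0" "\<And>z. z \<in> cball 0 1 \<Longrightarrow> dist (f z) (exp w) < \<delta> \<Longrightarrow> \<exists>y\<in>F. dist z y < e'"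
      using fibre_nbhd[OF e', of "exp w"] unfolding F_def by blast
    have "isCont exp w" by simp
    then obtain e where e: "e > 0" "\<And>w'. dist w' w < e \<Longrightarrow> dist (exp w') (exp w) < \<delta>"
      using dl(1) unfolding continuous_at_eps_delta by (metis dist_commute)
    have "\<exists>y\<in>F. dist (H w') y < e'" if "w' \<in> A" "dist w' w < e" for w'
      using dl(2)[of "H w'"] that A H_cball[of w'] f_H[of w'] e(2)[of w'] by auto
    with e(1) show ?thesis by blast
  qed
  obtain e0 where e0: "e0 > 0" "\<And>w'. w' \<in> A \<Longrightarrow> dist w' w < e0 \<Longrightarrow> \<exists>y\<in>F. dist (H w') y < r"
    using near[OF r(2)] by blast
  define e1 where "e1 = min e0 d"
  have e1: "e1 > 0" "e1 \<le> d" "e1 \<le> e0" using e0 d by (auto simp: e1_def)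
  obtain w1 where w1: "w1 \<in> A" "dist w1 w < e1"
    using nt e1(1) unfolding trivial_limit_within islimpt_approachable by blast
  then obtain y0 where y0: "y0 \<in> F" "dist (H w1) y0 < r" using e0(2)[of w1] e1 by auto
  have in0: "dist (H w') y0 < r" if w': "w' \<in> A" "dist w' w < e1" for w'
  proof (rule ccontr)
    assume n: "\<not> dist (H w') y0 < r"
    define Q where "Q = H ` (A \<inter> ball w e1)"
    have Qc: "connected Q" unfolding Q_def
      using e1 conn by (intro connected_continuous_image continuous_on_subset[OF H_cont]) (use A in auto)
    define U where "U = (\<Union>y\<in>F - {y0}. ball y r)"
    have "ball y0 r \<inter> ball y r = {}" if "y \<in> F - {y0}" for y
      by (rule disjoint_ballI) (use r(1)[OF y0(1), of y] that in auto)
    then have "ball y0 r \<inter> U = {}" by (auto simp: U_def)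
    moreover have "Q \<subseteq> ball y0 r \<union> U"
    proof
      fix q assume "q \<in> Q"
      then obtain v where v: "v \<in> A" "dist v w < e1" "q = H v" by (auto simp: Q_def dist_commute)
      then obtain y where "y \<in> F" "dist q y < r" using e0(2)[of v] e1 by auto
      then show "q \<in> ball y0 r \<union> U" by (cases "y = y0") (auto simp: U_def dist_commute)
    qed
    moreover have "open U" unfolding U_def by (intro open_UN ballI open_ball)
    ultimately have "ball y0 r \<inter> Q = {} \<or> U \<inter> Q = {}"
      using connectedD[OF Qc open_ball[of y0 r] \<open>open U\<close>] by blast
    moreover have "H w1 \<in> ball y0 r \<inter> Q" using w1 y0 by (auto simp: Q_def dist_commute)
    moreover have "H w' \<in> Q" using w' by (auto simp: Q_def dist_commute)
    ultimately have "H w' \<in> ball y0 r" using \<open>Q \<subseteq> ball y0 r \<union> U\<close> by blast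
    with n show False by (simp add: dist_commute)
  qed
  have "(H \<longlongrightarrow> y0) (at w within A)"
    unfolding Lim_within
  proof (intro allI impI)
    fix e :: real assume "e > 0"
    define e' where "e' = min e r"
    have "e' > 0" using \<open>e > 0\<close> r by (simp add: e'_def)
    then obtain e2 where e2: "e2 > 0" "\<And>w'. w' \<in> A \<Longrightarrow> dist w' w < e2 \<Longrightarrow> \<exists>y\<in>F. dist (H w') y < e'"
      using near by blast
    have "dist (H w') y0 < e" if w': "w' \<in> A" "dist w' w < min e1 e2" for w'
    proof -
      obtain y where y: "y \<in> F" "dist (H w') y < e'" using e2(2)[of w'] w' by auto
      have "dist (H w') y0 < r" using in0 w' by simp
      then have "dist y0 y < 2 * r" using dist_triangle2[of y0 y "H w'"] y(2) by (simp add: e'_def dist_commute)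
      then have "y = y0" using r(1)[OF y0(1) y(1)] by force
      then show ?thesis using y by (simp add: e'_def)
    qed
    then show "\<exists>d>0. \<forall>x\<in>A. 0 < dist x w \<and> dist x w < d \<longrightarrow> dist (H x) y0 < e"
      using e1 e2 by (intro exI[of _ "min e1 e2"]) auto
  qed
  then show ?thesis using y0 by (auto simp: F_def)
qed

text \<open>The one-sided limit of \<open>H\<close> at \<open>w\<close>, from above for \<open>s = 1\<close> and from below for \<open>s = -1\<close>. It always
exists, also over critical arguments and at critical points.\<close>

definition Hs :: "real \<Rightarrow> complex \<Rightarrow> complex" where
  "Hs s w = Lim (at w within side s (Im w)) H"

lemma Hs:
  assumes w: "Re w \<le> 0" and s: "s = 1 \<or> s = -1"
  shows Hs_tendsto: "(H \<longlongrightarrow> Hs s w) (at w within side s (Im w))"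
    and Hs_cball: "Hs s w \<in> cball 0 1" and f_Hs: "f (Hs s w) = exp w"
proof -
  obtain d where d: "d > 0" "\<And>y. y \<noteq> Im w \<Longrightarrow> dist y (Im w) < d \<Longrightarrow> cis y \<notin> Args"
    using Args_discrete by blast
  have "\<exists>l\<in>cball 0 1. f l = exp w \<and> (H \<longlongrightarrow> l) (at w within side s (Im w))"
  proof (rule connected_small_limit[OF _ w d(1) lim_nontrivial[OF w s]])
    show "side s (Im w) \<subseteq> comb" using side_Gen Gen_comb by blast
    fix e assume e: "0 < e" "e \<le> d"
    have gen: "cis (Im z) \<notin> Args" if "dist w z < e" "Im z \<noteq> Im w" for z
    proof (rule d(2)[OF that(2)])
      have "dist (Im z) (Im w) \<le> dist w z"
        using abs_Im_le_cmod[of "z - w"] by (simp add: dist_norm norm_minus_commute)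
      then show "dist (Im z) (Im w) < d" using that e by simp
    qed
    have "side s (Im w) \<inter> ball w e = ({z. Re z \<le> 0} \<inter> {z. 0 < s * (Im z - Im w)}) \<inter> ball w e"
      using gen s by (auto simp: side_def Gen_def)
    also have "{z. 0 < s * (Im z - Im w)} = (if s = 1 then {z. Im z > Im w} else {z. Im z < Im w})"
      using s by auto
    also have "convex ({z. Re z \<le> 0} \<inter> \<dots> \<inter> ball w e)"
      by (auto intro!: convex_Int convex_halfspace_Re_le convex_halfspace_Im_gt convex_halfspace_Im_lt)
    finally show "connected (side s (Im w) \<inter> ball w e)" by (rule convex_connected)
  qed
  then obtain l where l: "l \<in> cball 0 1" "f l = exp w" "(H \<longlongrightarrow> l) (at w within side s (Im w))" by blast
  then have "Hs s w = l" unfolding Hs_def by (intro tendsto_Lim lim_nontrivial w s)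
  with l show "(H \<longlongrightarrow> Hs s w) (at w within side s (Im w))" "Hs s w \<in> cball 0 1" "f (Hs s w) = exp w"
    by auto
qed

lemma Hs_unique:
  assumes "Re w \<le> 0" "s = 1 \<or> s = -1" "(H \<longlongrightarrow> l) (at w within side s (Im w))"
  shows "Hs s w = l"
  unfolding Hs_def using assms by (intro tendsto_Lim lim_nontrivial)

lemma H_tendsto_comb: "w \<in> comb \<Longrightarrow> A \<subseteq> Gen \<Longrightarrow> (H \<longlongrightarrow> H w) (at w within A)"
proof -
  assume w: "w \<in> comb" "A \<subseteq> Gen"
  then have "(H \<longlongrightarrow> H w) (at w within comb)" using H_cont by (simp add: continuous_on_def)
  then show ?thesis by (rule tendsto_within_subset) (use w Gen_comb in auto)
qed

lemma Hs_comb: "w \<in> comb \<Longrightarrow> s = 1 \<or> s = -1 \<Longrightarrow> Hs s w = H w"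
  by (rule Hs_unique[OF _ _ H_tendsto_comb[OF _ side_Gen]]) (auto simp: comb_def)

lemma continuous_on_limit_ext:
  fixes h l :: "'a::metric_space \<Rightarrow> 'b::metric_space"
  assumes lim: "\<And>x. x \<in> B \<Longrightarrow> (h \<longlongrightarrow> l x) (at x within A)"
    and nt: "\<And>x. x \<in> B \<Longrightarrow> at x within A \<noteq> bot"
  shows "continuous_on B l"
  unfolding continuous_on_iff
proof (intro ballI allI impI)
  fix x and e :: real assume x: "x \<in> B" and e: "e > 0"
  obtain d where d: "d > 0" "\<And>a. a \<in> A \<Longrightarrow> 0 < dist a x \<Longrightarrow> dist a x < d \<Longrightarrow> dist (h a) (l x) < e/2"
    using lim[OF x, unfolded Lim_within] e by (meson half_gt_zero)
  have "dist (l y) (l x) < e" if y: "y \<in> B" "dist y x < d" for y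
  proof (cases "y = x")
    case False
    define d' where "d' = min (dist y x) (d - dist y x)"
    have "d' > 0" using False y by (simp add: d'_def)
    obtain d2 where d2: "d2 > 0" "\<And>a. a \<in> A \<Longrightarrow> 0 < dist a y \<Longrightarrow> dist a y < d2 \<Longrightarrow> dist (h a) (l y) < e/2"
      using lim[OF y(1), unfolded Lim_within] e by (meson half_gt_zero)
    obtain a where a: "a \<in> A" "a \<noteq> y" "dist a y < min d' d2"
      using nt[OF y(1)] \<open>d' > 0\<close> d2(1) unfolding trivial_limit_within islimpt_approachable
      by (metis min_less_iff_conj)
    have "dist a x < d" using a dist_triangle[of a x y] by (simp add: d'_def)
    moreover have "a \<noteq> x" using a by (auto simp: d'_def dist_commute)
    ultimately have "dist (h a) (l x) < e/2" using d a by simp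
    moreover have "dist (h a) (l y) < e/2" using d2 a by simp
    ultimately show ?thesis using dist_triangle3[of "l y" "l x" "h a"] by simp
  qed (use e in simp)
  then show "\<exists>d>0. \<forall>x'\<in>B. dist x' x < d \<longrightarrow> dist (l x') (l x) < e" using d(1) by blast
qed

lemma Hs_line_cont:
  assumes s: "s = 1 \<or> s = -1"
  shows "continuous_on {..0} (\<lambda>t. Hs s (Complex t x))"
proof -
  have "continuous_on {w. Re w \<le> 0 \<and> Im w = x} (Hs s)"
    by (rule continuous_on_limit_ext[where A="side s x" and h=H])
      (use Hs_tendsto[OF _ s] lim_nontrivial[OF _ s] in auto)
  then show ?thesis
    by (rule continuous_on_compose2) (auto intro!: continuous_intros)
qed

text \<open>A point is regular if \<open>H\<close> has a limit there, that is, if its two one-sided limits agree.\<close>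

definition reg :: "complex \<Rightarrow> bool" where
  "reg w \<longleftrightarrow> (\<exists>l. (H \<longlongrightarrow> l) (at w within Gen))"

lemma reg_comb: "w \<in> comb \<Longrightarrow> reg w"
  using H_tendsto_comb[of w Gen] by (auto simp: reg_def)

lemma not_reg:
  assumes "Re w \<le> 0" "\<not> reg w"
  shows "Hs 1 w \<noteq> Hs (-1) w"
proof
  assume eq: "Hs 1 w = Hs (-1) w"
  have "w \<notin> comb" using assms reg_comb by blast
  then have "cis (Im w) \<in> Args" using assms(1) by (simp add: comb_def)
  then have "Im u \<noteq> Im w" if "u \<in> Gen" for u using that by (auto simp: Gen_def)
  then have "u \<in> side 1 (Im w) \<union> side (-1) (Im w)" if "u \<in> Gen" for u
    using that by (auto simp: side_def neq_iff)
  then have "Gen = side 1 (Im w) \<union> side (-1) (Im w)" using side_Gen by blast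
  moreover have "(H \<longlongrightarrow> Hs 1 w) (at w within side 1 (Im w))"
    "(H \<longlongrightarrow> Hs 1 w) (at w within side (-1) (Im w))"
    using Hs_tendsto[OF assms(1), of 1] Hs_tendsto[OF assms(1), of "-1"] eq by auto
  ultimately have "(H \<longlongrightarrow> Hs 1 w) (at w within Gen)" by (metis Lim_within_Un)
  with assms show False by (auto simp: reg_def)
qed

lemma Hs_period:
  assumes "Re w \<le> 0" "s = 1 \<or> s = -1"
  shows "Hs s (w + Complex 0 (2*pi * n * of_int k)) = Hs s w"
proof (rule Hs_unique)
  define c where "c = Complex 0 (2*pi * n * of_int k)"
  have sd: "u - c \<in> side s (Im w)" if "u \<in> side s (Im (w + c))" for u
    using that cis_period_n[of "Im u" "-k"] by (auto simp: side_def Gen_def c_def algebra_simps)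
  have per: "H u = H (u - c)" if "u \<in> side s (Im (w + c))" for u
    using H_period[of "u - c" k] sd[OF that] Gen_comb side_Gen by (auto simp: c_def)
  show "(H \<longlongrightarrow> Hs s w) (at (w + c) within side s (Im (w + c)))"
    unfolding Lim_within
  proof (intro allI impI)
    fix e :: real assume "e > 0"
    then obtain d where d: "d > 0" "\<And>u. u \<in> side s (Im w) \<Longrightarrow> 0 < dist u w \<Longrightarrow> dist u w < d \<Longrightarrow> dist (H u) (Hs s w) < e"
      using Hs_tendsto[OF assms, unfolded Lim_within] by metis
    have "dist (H u) (Hs s w) < e" if "u \<in> side s (Im (w + c))" "0 < dist u (w + c)" "dist u (w + c) < d" for u
    proof -
      have "dist (u - c) w = dist u (w + c)" by (simp add: dist_norm algebra_simps)
      then show ?thesis using d(2)[OF sd[OF that(1)]] per[OF that(1)] that by simp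
    qed
    then show "\<exists>d>0. \<forall>u\<in>side s (Im (w + c)). 0 < dist u (w + c) \<and> dist u (w + c) < d \<longrightarrow> dist (H u) (Hs s w) < e"
      using d(1) by blast
  qed
qed (use assms in auto)

text \<open>Every point of the disc over \<open>exp w\<close> is a limit from above of some sheet: by openness of \<open>f\<close> there
are points arbitrarily close to it whose argument is slightly larger and noncritical.\<close>

lemma fibre_Hs:
  assumes y: "y \<in> ball 0 1" "f y = exp w" and w: "Re w < 0"
  shows "\<exists>k::int. Hs 1 (w + Complex 0 (2*pi* of_int k)) = y"
proof (rule ccontr)
  assume neg: "\<not> ?thesis"
  define W where "W k = w + Complex 0 (2*pi* of_int (int k))" for k :: nat
  have ne: "Hs 1 (W k) \<noteq> y" for k using neg unfolding W_def by blast
  have "\<forall>\<^sub>F e in at_right 0. \<forall>k\<in>{..<n}. e \<le> dist y (Hs 1 (W k)) / 2"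
  proof (intro eventually_ball_finite ballI)
    fix k
    show "\<forall>\<^sub>F e in at_right 0. e \<le> dist y (Hs 1 (W k)) / 2"
      unfolding eventually_at_right_field
      by (rule exI[of _ "dist y (Hs 1 (W k)) / 2"]) (use ne[of k] in auto)
  qed simp
  moreover have "\<forall>\<^sub>F r in at_right (0::real). r > 0" by (simp add: eventually_at_right_less)
  ultimately have "\<forall>\<^sub>F e in at_right 0. (\<forall>k\<in>{..<n}. e \<le> dist y (Hs 1 (W k)) / 2) \<and> e > 0"
    by eventually_elim auto
  from eventually_happens'[OF trivial_limit_at_right_real this]
  obtain e where e: "e > 0" "\<And>k. k < n \<Longrightarrow> e \<le> dist y (Hs 1 (W k)) / 2" by auto
  have h1: "\<forall>\<^sub>F t in at_right 0. \<forall>k\<in>{..<n}. Complex 0 t + W k \<in> Gen \<longrightarrow> dist (H (Complex 0 t + W k)) (Hs 1 (W k)) < e"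
  proof (intro eventually_ball_finite ballI)
    fix k
    have "(H \<longlongrightarrow> Hs 1 (W k)) (at (W k) within side 1 (Im (W k)))"
      by (rule Hs_tendsto) (use w in \<open>auto simp: W_def\<close>)
    then obtain d where d: "d > 0" "\<And>u. u \<in> side 1 (Im (W k)) \<Longrightarrow> 0 < dist u (W k) \<Longrightarrow> dist u (W k) < d
        \<Longrightarrow> dist (H u) (Hs 1 (W k)) < e"
      using e(1) unfolding Lim_within by meson
    show "\<forall>\<^sub>F t in at_right 0. Complex 0 t + W k \<in> Gen \<longrightarrow> dist (H (Complex 0 t + W k)) (Hs 1 (W k)) < e"
      unfolding eventually_at_right_field
    proof (intro exI[of _ d] conjI allI impI)
      fix t assume t: "0 < t" "t < d" "Complex 0 t + W k \<in> Gen"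
      show "dist (H (Complex 0 t + W k)) (Hs 1 (W k)) < e"
        by (rule d(2)) (use t in \<open>auto simp: side_def dist_norm cmod_def\<close>)
    qed (use d in auto)
  qed simp
  have "open (f ` (ball y e \<inter> ball 0 1))"
    by (rule f_open_map) (use cball_Om ball_subset_cball in blast)+
  moreover have "exp w \<in> f ` (ball y e \<inter> ball 0 1)" using y e(1) by (auto intro!: image_eqI[of _ f y])
  moreover have "((\<lambda>t. exp (Complex 0 t + w)) \<longlongrightarrow> exp w) (at_right 0)"
  proof -
    have "((\<lambda>t. exp (Complex 0 t + w)) \<longlongrightarrow> exp (Complex 0 0 + w)) (at_right 0)"
      by (intro tendsto_intros)
    then show ?thesis by (simp add: zero_complex.code[symmetric])
  qed
  ultimately have h2: "\<forall>\<^sub>F t in at_right 0. exp (Complex 0 t + w) \<in> f ` (ball y e \<inter> ball 0 1)"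
    by (rule topological_tendstoD[rotated])
  have h3: "\<forall>\<^sub>F t in at_right 0. cis (Im w + t) \<notin> Args"
  proof -
    obtain d where "d > 0" "\<And>y. y \<noteq> Im w \<Longrightarrow> dist y (Im w) < d \<Longrightarrow> cis y \<notin> Args"
      using Args_discrete by blast
    then show ?thesis unfolding eventually_at_right_field
      by (intro exI[of _ d]) (auto simp: dist_real_def)
  qed
  have "\<forall>\<^sub>F t in at_right 0. (\<forall>k\<in>{..<n}. Complex 0 t + W k \<in> Gen \<longrightarrow> dist (H (Complex 0 t + W k)) (Hs 1 (W k)) < e)
     \<and> exp (Complex 0 t + w) \<in> f ` (ball y e \<inter> ball 0 1) \<and> cis (Im w + t) \<notin> Args"
    using h1 h2 h3 by eventually_elim auto
  from eventually_happens'[OF trivial_limit_at_right_real this]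
  obtain t where t1: "\<And>k. k < n \<Longrightarrow> Complex 0 t + W k \<in> Gen \<Longrightarrow> dist (H (Complex 0 t + W k)) (Hs 1 (W k)) < e"
    and t2: "exp (Complex 0 t + w) \<in> f ` (ball y e \<inter> ball 0 1)" and t3: "cis (Im w + t) \<notin> Args"
    by blast
  obtain z where z: "dist y z < e" "z \<in> ball 0 1" "f z = exp (Complex 0 t + w)" using t2 by auto
  have g: "Complex 0 t + w \<in> Gen" using t3 w by (simp add: Gen_def add.commute)
  obtain m :: int where m: "z = H (Complex 0 t + w + Complex 0 (2*pi* of_int m))"
    using H_onto[of z "Complex 0 t + w"] z Gen_comb[OF g] by auto
  define k where "k = nat (m mod int n)"
  have k: "k < n" "int k = m mod int n" using n_pos by (auto simp: k_def nat_less_iff)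
  have "m = int k + int n * (m div int n)" using k by simp
  then have "real_of_int m = real k + real n * of_int (m div int n)"
    by (metis of_int_add of_int_mult of_int_of_nat_eq)
  then have mm: "Complex 0 t + w + Complex 0 (2*pi* of_int m) = Complex 0 t + W k + Complex 0 (2*pi * n * of_int (m div int n))"
    by (simp add: W_def complex_eq_iff algebra_simps)
  have gk: "Complex 0 t + W k \<in> Gen"
    using g cis_period[of "t + Im w" "int k"] by (simp add: Gen_def W_def algebra_simps)
  have "z = H (Complex 0 t + W k)" unfolding m mm by (rule H_period) (use gk Gen_comb in auto)
  then have "dist z (Hs 1 (W k)) < e" using t1[OF k(1) gk] by simp
  moreover have "2 * e \<le> dist y (Hs 1 (W k))" using e(2)[OF k(1)] by simp
  ultimately show False using z(1) dist_triangle[of y "Hs 1 (W k)" z] by simp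
qed

end

section \<open>Ascents and planarity\<close>

lemma cot_less:
  assumes "0 < x" "x < y" "y < pi"
  shows "cos y / sin y < cos x / sin (x::real)"
proof -
  have s: "sin x > 0" "sin y > 0" "sin (y - x) > 0" using assms by (auto intro!: sin_gt_zero)
  have "cos x / sin x - cos y / sin y = sin (y - x) / (sin x * sin y)"
    using s by (simp add: field_simps sin_diff)
  also have "\<dots> > 0" using s by simp
  finally show ?thesis by simp
qed

text \<open>The Cayley map sends the closed disc without \<open>cis m\<close> to the closed upper half-plane and the circle
increasingly to the real line. It reduces the crossing of paths in the disc to that of paths in a
rectangle whose ends lie on the lower edge.\<close>

definition cayley :: "real \<Rightarrow> complex \<Rightarrow> complex" where
  "cayley m z = \<i> * (cis m + z) / (cis m - z)"

lemma cayley_cis: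
  assumes "m - 2*pi < t" "t < m"
  shows "cayley m (cis t) = of_real (cos ((m - t)/2) / sin ((m - t)/2))"
proof -
  define u where "u = (m - t)/2"
  define c where "c = cis ((m + t)/2)"
  have u: "0 < u" "u < pi" using assms by (auto simp: u_def)
  then have s: "sin u \<noteq> 0" using sin_gt_zero by force
  have e: "cis m = c * cis u" "cis t = c * cis (-u)"
    by (simp_all add: c_def u_def cis_mult field_simps)
  have a: "cis m + cis t = c * (2 * of_real (cos u))"
    unfolding e by (simp add: complex_eq_iff algebra_simps)
  have b: "cis m - cis t = c * (2 * \<i> * of_real (sin u))"
    unfolding e by (simp add: complex_eq_iff algebra_simps)
  have c0: "c \<noteq> 0" by (simp add: c_def)
  show ?thesis unfolding cayley_def a b u_def[symmetric] using s c0 by (simp add: field_simps)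
qed

lemma Im_cayley_nonneg:
  assumes "cmod z \<le> 1"
  shows "Im (cayley m z) \<ge> 0"
proof -
  have "Im (cayley m z) = ((cmod (cis m))\<^sup>2 - (cmod z)\<^sup>2) / (cmod (cis m - z))\<^sup>2"
    unfolding cayley_def cmod_power2 by (simp add: Im_divide power2_eq_square algebra_simps)
  moreover have "(cmod z)\<^sup>2 \<le> 1" using assms by (simp add: abs_square_le_1)
  ultimately show ?thesis by simp
qed

lemma cayley_inj:
  assumes "z \<noteq> cis m" "z' \<noteq> cis m" "cayley m z = cayley m z'"
  shows "z = z'"
proof -
  have "(cis m + z) * (cis m - z') = (cis m + z') * (cis m - z)"
    using assms by (simp add: cayley_def field_simps)
  then have "cis m * (z - z') = 0" by (simp add: algebra_simps)
  then show ?thesis by simp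
qed

(* leaves $ to vector components *)
unbundle no fps_syntax

text \<open>Paths in the disc that join interlaced boundary points intersect.\<close>

lemma disc_paths_cross:
  assumes g: "path g" "path_image g \<subseteq> ball 0 1 \<union> {cis a, cis c}" "pathstart g = cis a" "pathfinish g = cis c"
    and h: "path h" "path_image h \<subseteq> ball 0 1 \<union> {cis b, cis d}" "pathstart h = cis b" "pathfinish h = cis d"
    and ord: "a < b" "b < c" "c < d" "d < a + 2*pi"
  shows "\<exists>z. z \<in> path_image g \<and> z \<in> path_image h"
proof -
  \<comment> \<open>the point sent to infinity lies on the arc from d to a, off both paths\<close>
  define m where "m = (d + a + 2*pi) / 2"
  have m: "d < m" "m < a + 2*pi" using ord by (auto simp: m_def)
  define V :: "complex \<Rightarrow> real^2" where "V z = (\<chi> i. if i = 1 then Re (cayley m z) else Im (cayley m z))" for z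
  have V: "V z $ 1 = Re (cayley m z)" "V z $ 2 = Im (cayley m z)" for z by (auto simp: V_def)
  have nm: "cis t \<noteq> cis m" if "m - 2*pi < t" "t < m" for t
  proof
    assume "cis t = cis m"
    then obtain k :: int where k: "t = m + 2*pi*k" unfolding cis_eq_cis_iff by blast
    then have "2*pi * real_of_int k < 2*pi*0" "2*pi*(-1) < 2*pi* real_of_int k" using that by simp_all
    then have "real_of_int k < 0" "-1 < real_of_int k"
      using mult_less_cancel_left_pos[of "2*pi" "real_of_int k" 0] mult_less_cancel_left_pos[of "2*pi" "-1" "real_of_int k"] pi_gt_zero
      by (simp_all only: mult_pos_pos zero_less_numeral)
    then have "k < 0" "real_of_int (-1) < real_of_int k" by simp_all
    then have "k < 0" "-1 < k" unfolding of_int_less_iff by simp_all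
    then show False by simp
  qed
  have rng: "m - 2*pi < t \<and> t < m" if "t \<in> {a, b, c, d}" for t using that m ord by auto
  have avoid: "z \<noteq> cis m \<and> cmod z \<le> 1" if "z \<in> path_image g \<union> path_image h" for z
  proof -
    have "z \<in> ball 0 1 \<or> z \<in> {cis a, cis b, cis c, cis d}" using that g(2) h(2) by blast
    then show ?thesis
    proof
      assume "z \<in> ball 0 1"
      then show ?thesis by auto
    next
      assume "z \<in> {cis a, cis b, cis c, cis d}"
      then obtain t where "t \<in> {a, b, c, d}" "z = cis t" by blast
      then show ?thesis using nm rng by simp
    qed
  qed
  have Vc: "continuous_on (path_image g \<union> path_image h) V"
    unfolding V_def
  proof (rule continuous_on_vec_lambda)
    fix i :: 2
    have "continuous_on (path_image g \<union> path_image h) (cayley m)"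
      unfolding cayley_def using avoid by (intro continuous_intros) auto
    then show "continuous_on (path_image g \<union> path_image h)
        (\<lambda>z. if i = 1 then Re (cayley m z) else Im (cayley m z))"
      by (cases "i = 1") (auto intro!: continuous_intros)
  qed
  have "compact (path_image g \<union> path_image h)" using g(1) h(1) by (simp add: compact_Un compact_path_image)
  then have "compact (V ` (path_image g \<union> path_image h))" by (rule compact_continuous_image[OF Vc])
  then obtain M where M: "\<And>z. z \<in> path_image g \<union> path_image h \<Longrightarrow> norm (V z) \<le> M"
    using compact_imp_bounded bounded_iff by (metis image_eqI)
  define A :: "real^2" where "A = (\<chi> i. if i = 1 then -M else 0)"
  define D :: "real^2" where "D = (\<chi> i. M)"
  have AD: "A $ 1 = -M" "A $ 2 = 0" "D $ 1 = M" "D $ 2 = M" by (auto simp: A_def D_def)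
  have box: "V z \<in> cbox A D" if "z \<in> path_image g \<union> path_image h" for z
  proof -
    have "\<bar>V z $ 1\<bar> \<le> M" "\<bar>V z $ 2\<bar> \<le> M" using M[OF that] component_le_norm_cart[of "V z"] order_trans by blast+
    moreover have "V z $ 2 \<ge> 0" using avoid[OF that] Im_cayley_nonneg by (simp add: V)
    ultimately show ?thesis by (auto simp: mem_box_cart forall_2 AD)
  qed
  have bd: "V (cis t) $ 2 = 0" "V (cis t) $ 1 = cos ((m - t)/2) / sin ((m - t)/2)" if "t \<in> {a, b, c, d}" for t
    using cayley_cis[of m t] rng[OF that] by (simp_all add: V)
  have inc: "V (cis s) $ 1 < V (cis t) $ 1" if "s \<in> {a, b, c, d}" "t \<in> {a, b, c, d}" "s < t" for s t
    unfolding bd(2)[OF that(1)] bd(2)[OF that(2)] using rng[OF that(1)] rng[OF that(2)] that(3) by (intro cot_less) auto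
  obtain y where y: "y \<in> path_image (V \<circ> g)" "y \<in> path_image (V \<circ> h)"
  proof (rule fashoda_interlace[of "V \<circ> g" "V \<circ> h" A D])
    show "path (V \<circ> g)" "path (V \<circ> h)"
      using g(1) h(1) by (auto intro!: path_continuous_image continuous_on_subset[OF Vc])
    show "path_image (V \<circ> g) \<subseteq> cbox A D" "path_image (V \<circ> h) \<subseteq> cbox A D"
      using box by (auto simp: path_image_compose)
  qed (use g(3,4) h(3,4) bd inc ord in \<open>auto simp: pathstart_compose pathfinish_compose AD\<close>)
  then obtain z z' where z: "z \<in> path_image g" "y = V z" "z' \<in> path_image h" "y = V z'"
    by (auto simp: path_image_compose)
  then have "cayley m z = cayley m z'" by (metis V complex_eq_iff)
  then have "z = z'" using cayley_inj avoid z by blast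
  with z show ?thesis by blast
qed

context disc_map
begin

text \<open>An ascent from \<open>p\<close> to the boundary point \<open>zeta x\<close>: a path \<open>\<sigma>\<close> with \<open>f (\<sigma> t) = exp (t + \<i> x)\<close>, where
\<open>t\<close> increases from \<open>r\<close> to \<open>0\<close>. It may pass through critical points, so a point can have
several ascents.\<close>

definition ascent :: "real \<Rightarrow> complex \<Rightarrow> real \<Rightarrow> (real \<Rightarrow> complex) \<Rightarrow> bool" where
  "ascent r p x \<sigma> \<longleftrightarrow> r \<le> 0 \<and> continuous_on {r..0} \<sigma> \<and>
     (\<forall>t\<in>{r..0}. \<sigma> t \<in> cball 0 1 \<and> f (\<sigma> t) = exp (Complex t x)) \<and> \<sigma> r = p \<and> \<sigma> 0 = zeta x"

definition asc :: "real \<Rightarrow> complex \<Rightarrow> real \<Rightarrow> bool" where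
  "asc r p x \<longleftrightarrow> (\<exists>\<sigma>. ascent r p x \<sigma>)"

lemma asc_f: "asc r p x \<Longrightarrow> f p = exp (Complex r x)"
  by (force simp: asc_def ascent_def)

lemma asc_cis: "asc r p x \<Longrightarrow> asc r q y \<Longrightarrow> f p = f q \<Longrightarrow> cis x = cis y"
  using asc_f[of r p x] asc_f[of r q y] sgn_exp_complex[of "Complex r x"] sgn_exp_complex[of "Complex r y"]
  by simp

lemma asc_Hs:
  assumes "r \<le> 0" "s = 1 \<or> s = -1"
  shows "asc r (Hs s (Complex r x)) x"
proof -
  have "ascent r (Hs s (Complex r x)) x (\<lambda>t. Hs s (Complex t x))"
    unfolding ascent_def
    using assms Hs_cball[of "Complex _ x" s] f_Hs[of "Complex _ x" s] Hs_comb[OF comb_imag assms(2)]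
    by (auto intro: continuous_on_subset[OF Hs_line_cont] simp: H_imag)
  then show ?thesis by (auto simp: asc_def)
qed

lemma ascent_asc: "ascent r p x \<sigma> \<Longrightarrow> t \<in> {r..0} \<Longrightarrow> asc t (\<sigma> t) x"
  unfolding asc_def ascent_def by (intro exI[of _ \<sigma>]) (auto intro: continuous_on_subset)

lemma ascent_ball: "ascent r p x \<sigma> \<Longrightarrow> t \<in> {r..<0} \<Longrightarrow> \<sigma> t \<in> ball 0 1"
proof -
  assume a: "ascent r p x \<sigma>" "t \<in> {r..<0}"
  then have "\<sigma> t \<in> cball 0 1" "cmod (f (\<sigma> t)) < 1" by (auto simp: ascent_def)
  then show ?thesis using norm_less[of "\<sigma> t"] cball_Om by (auto dest: subsetD[where c="\<sigma> t"])
qed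

text \<open>An ascent may be left at any of its points in favour of another ascent.\<close>

lemma asc_join:
  assumes s: "ascent r p x \<sigma>" "t \<in> {r..0}" and y: "asc t (\<sigma> t) y"
  shows "asc r p y"
proof -
  obtain \<rho> where \<rho>: "ascent t (\<sigma> t) y \<rho>" using y by (auto simp: asc_def)
  have "cis x = cis y" using asc_cis[OF ascent_asc[OF s] y] by simp
  define \<nu> where "\<nu> u = (if u \<le> t then \<sigma> u else \<rho> u)" for u
  have "continuous_on ({r..t} \<union> {t..0}) \<nu>"
    unfolding \<nu>_def
    using s \<rho> by (intro continuous_on_cases) (auto simp: ascent_def intro: continuous_on_subset)
  moreover have "{r..t} \<union> {t..0} = {r..0}" using s(2) by auto
  moreover have "\<nu> u \<in> cball 0 1 \<and> f (\<nu> u) = exp (Complex u y)" if "u \<in> {r..0}" for u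
    using s \<rho> that exp_Complex_cong[OF \<open>cis x = cis y\<close>, of u] by (auto simp: ascent_def \<nu>_def)
  moreover have "\<nu> 0 = zeta y" using \<rho> s by (auto simp: ascent_def \<nu>_def)
  ultimately have "ascent r p y \<nu>" using s by (auto simp: ascent_def \<nu>_def)
  then show ?thesis by (auto simp: asc_def)
qed

lemma asc_shift: "asc r p x \<Longrightarrow> asc r p (x + 2 * pi * n * of_int k)"
proof -
  assume "asc r p x"
  then obtain \<sigma> where s: "ascent r p x \<sigma>" by (auto simp: asc_def)
  have "zeta (x + 2 * pi * n * of_int k) = zeta x" by (auto simp: zeta_eq_iff)
  then have "ascent r p (x + 2 * pi * n * of_int k) \<sigma>"
    using s exp_Complex_cong[OF cis_period_n[of x k]] by (simp add: ascent_def)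
  then show ?thesis by (auto simp: asc_def)
qed

lemma ascent_path:
  assumes "ascent r p x \<sigma>"
  shows "\<exists>g. path g \<and> pathstart g = p \<and> pathfinish g = zeta x \<and> path_image g = \<sigma> ` {r..0}"
proof -
  define g where "g = \<sigma> \<circ> (\<lambda>u. r * (1 - u))"
  have r: "r \<le> 0" using assms by (simp add: ascent_def)
  have im: "(\<lambda>u. r * (1 - u)) ` {0..1} = {r..0}"
  proof
    show "(\<lambda>u. r * (1 - u)) ` {0..1} \<subseteq> {r..0}"
    proof
      fix v assume "v \<in> (\<lambda>u. r * (1 - u)) ` {0..1}"
      then obtain u where u: "0 \<le> u" "u \<le> 1" "v = r * (1 - u)" by auto
      have "0 \<le> (-r) * (1 - u)" "0 \<le> (-r) * u" using u r by (intro mult_nonneg_nonneg; simp)+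
      then show "v \<in> {r..0}" using u by (simp add: algebra_simps)
    qed
    show "{r..0} \<subseteq> (\<lambda>u. r * (1 - u)) ` {0..1}"
    proof (cases "r = 0")
      case False
      show ?thesis
      proof
        fix v assume v: "v \<in> {r..0}"
        have "v = r * (1 - (1 - v / r))" using False by simp
        moreover have "1 - v / r \<in> {0..1}" using v r False by (auto simp: divide_simps)
        ultimately show "v \<in> (\<lambda>u. r * (1 - u)) ` {0..1}" by blast
      qed
    next
      case True
      then have "{r..0} = {r * (1 - 0)}" by simp
      moreover have "(0::real) \<in> {0..1}" by simp
      ultimately show ?thesis by blast
    qed
  qed
  have "path g" unfolding path_def g_def
    using assms by (intro continuous_on_compose) (auto intro!: continuous_intros simp: im ascent_def)
  moreover have "path_image g = \<sigma> ` {r..0}" unfolding path_image_def g_def by (simp only: image_comp[symmetric] im)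
  moreover have "pathstart g = p" "pathfinish g = zeta x"
    using assms by (auto simp: g_def pathstart_def pathfinish_def ascent_def)
  ultimately show ?thesis by blast
qed

lemma ascent_image: "ascent r p x \<sigma> \<Longrightarrow> \<sigma> ` {r..0} \<subseteq> ball 0 1 \<union> {zeta x}"
proof
  fix z assume a: "ascent r p x \<sigma>" "z \<in> \<sigma> ` {r..0}"
  then obtain t where t: "t \<in> {r..0}" "z = \<sigma> t" by auto
  then show "z \<in> ball 0 1 \<union> {zeta x}"
    using ascent_ball[OF a(1), of t] a(1) by (cases "t = 0") (auto simp: ascent_def)
qed

lemma ascent_pair_path:
  assumes "ascent r p x \<sigma>" "ascent r p y \<rho>"
  shows "\<exists>g. path g \<and> pathstart g = zeta x \<and> pathfinish g = zeta y \<and> path_image g = \<sigma> ` {r..0} \<union> \<rho> ` {r..0}"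
proof -
  obtain g1 where g1: "path g1" "pathstart g1 = p" "pathfinish g1 = zeta x" "path_image g1 = \<sigma> ` {r..0}"
    using ascent_path[OF assms(1)] by blast
  obtain g2 where g2: "path g2" "pathstart g2 = p" "pathfinish g2 = zeta y" "path_image g2 = \<rho> ` {r..0}"
    using ascent_path[OF assms(2)] by blast
  show ?thesis using g1 g2
    by (intro exI[of _ "reversepath g1 +++ g2"]) (simp add: path_image_join)
qed

lemma tau_less_shift: "x < y + 2 * pi * n \<Longrightarrow> tau x < tau y + 2 * pi"
  using tau_shift[of y 1] tau_less[of x "y + 2*pi*n"] by simp

lemma zeta_paths_cross:
  assumes "path g" "path_image g \<subseteq> ball 0 1 \<union> {zeta a, zeta c}" "pathstart g = zeta a" "pathfinish g = zeta c"
    and "path h" "path_image h \<subseteq> ball 0 1 \<union> {zeta b, zeta d}" "pathstart h = zeta b" "pathfinish h = zeta d"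
    and "a < b" "b < c" "c < d" "d < a + 2 * pi * n"
  shows "\<exists>z. z \<in> path_image g \<and> z \<in> path_image h"
  using assms unfolding zeta_def
  by (intro disc_paths_cross[of g "tau a" "tau c" h "tau b" "tau d"]) (auto simp: tau_less tau_less_shift)

text \<open>Planarity: of two pairs of ascents with interlaced ends, some point has an ascent to an end of the
first pair and one to the inner end \<open>b\<close> of the second.\<close>

lemma asc_cross:
  assumes p: "asc r p a" "asc r p c" and q: "asc r' q b" "asc r' q d"
    and r: "r < 0" "r' < 0"
    and ord: "a < b" "b < c" "c < d" "d < a + 2 * pi * n"
  shows "\<exists>t z. t < 0 \<and> min r r' \<le> t \<and> asc t z b \<and> (asc t z a \<or> asc t z c)"
proof -
  obtain s1 s2 s3 s4 where s: "ascent r p a s1" "ascent r p c s2" "ascent r' q b s3" "ascent r' q d s4"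
    using p q by (auto simp: asc_def)
  obtain g where g: "path g" "pathstart g = zeta a" "pathfinish g = zeta c"
      "path_image g = s1 ` {r..0} \<union> s2 ` {r..0}"
    using ascent_pair_path[OF s(1,2)] by blast
  obtain h where h: "path h" "pathstart h = zeta b" "pathfinish h = zeta d"
      "path_image h = s3 ` {r'..0} \<union> s4 ` {r'..0}"
    using ascent_pair_path[OF s(3,4)] by blast
  obtain z where z: "z \<in> path_image g" "z \<in> path_image h"
    using zeta_paths_cross[of g a c h b d] g h ord ascent_image[OF s(1)] ascent_image[OF s(2)]
      ascent_image[OF s(3)] ascent_image[OF s(4)] by blast
  obtain t \<sigma> x where t: "t \<in> {r..0}" "z = \<sigma> t" "ascent r p x \<sigma>" "x = a \<or> x = c"
    using z(1) s(1,2) unfolding g(4) by blast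
  obtain t' \<rho> y where t': "t' \<in> {r'..0}" "z = \<rho> t'" "ascent r' q y \<rho>" "y = b \<or> y = d"
    using z(2) s(3,4) unfolding h(4) by blast
  have "f z = exp (Complex t x)" using t by (auto simp: ascent_def)
  moreover have "f z = exp (Complex t' y)" using t' by (auto simp: ascent_def)
  ultimately have tt: "t' = t" by (metis complex.sel(1) exp_le_cancel_iff norm_exp_eq_Re order_antisym order_refl)
  have zx: "asc t z x" using ascent_asc[OF t(3,1)] t(2) by simp
  have zy: "asc t z y" using ascent_asc[OF t'(3,1)] t'(2) tt by simp
  have "x \<noteq> y" using t(4) t'(4) ord by auto
  have "t < 0"
  proof (rule ccontr)
    assume "\<not> t < 0"
    then have "t = 0" using t(1) by simp
    then have "z = zeta x" "z = zeta y" using t t' tt by (auto simp: ascent_def)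
    then obtain k :: int where k: "x = y + 2 * pi * n * k" using \<open>z = zeta x\<close> \<open>z = zeta y\<close> zeta_eq_iff by metis
    have "\<bar>x - y\<bar> < 2 * pi * n" using t(4) t'(4) ord by auto
    then have "(2 * pi * n) * \<bar>real_of_int k\<bar> < (2 * pi * n) * 1" using k by (simp add: abs_mult)
    moreover have "2 * pi * n > 0" using n_pos by simp
    ultimately have "\<bar>real_of_int k\<bar> < 1" using mult_less_cancel_left_pos by blast
    then have "k = 0" by linarith
    with k \<open>x \<noteq> y\<close> show False by simp
  qed
  show ?thesis
  proof (cases "y = b")
    case True
    then show ?thesis using zx zy t t' tt \<open>t < 0\<close> by (rule_tac exI[of _ t], rule_tac exI[of _ z]) auto
  next
    case False
    \<comment> \<open>\<open>q\<close> ascends to the meeting point \<open>z\<close> towards \<open>d\<close>, and from there to \<open>x\<close>\<close>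
    have "asc r' q x" using asc_join[OF t'(3,1)] zx t'(2) tt by simp
    then show ?thesis using q(1) r t(4) by (rule_tac exI[of _ r'], rule_tac exI[of _ q]) auto
  qed
qed

text \<open>At an irregular point the limit from below is also the limit from above of a sheet, and this sheet
is a different one.\<close>

lemma not_reg_pair:
  assumes w: "Re w < 0" "\<not> reg w"
  shows "\<exists>y d. a \<le> d \<and> d < a + 2 * pi * n \<and> d \<noteq> Im w \<and> asc (Re w) y (Im w) \<and> asc (Re w) y d"
proof -
  define y where "y = Hs (-1) w"
  define b where "b = Im w"
  have wb: "w = Complex (Re w) b" by (simp add: b_def)
  have yb: "asc (Re w) y b" using asc_Hs[of "Re w" "-1" b] w(1) wb by (simp add: y_def)
  have "y \<in> ball 0 1"
    using yb ascent_ball[of "Re w" y b _ "Re w"] w(1) by (auto simp: asc_def) (auto simp: ascent_def)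
  moreover have "f y = exp w" using f_Hs[of w "-1"] w(1) by (simp add: y_def)
  ultimately obtain k :: int where k: "Hs 1 (w + Complex 0 (2 * pi * of_int k)) = y"
    using fibre_Hs w(1) by blast
  define d0 where "d0 = b + 2 * pi * of_int k"
  \<comment> \<open>the label is moved into the period that starts at a\<close>
  define j where "j = - \<lfloor>(d0 - a) / (2 * pi * n)\<rfloor>"
  define d where "d = d0 + 2 * pi * n * of_int j"
  have N: "2 * pi * n > 0" using n_pos by simp
  have "of_int (-j) \<le> (d0 - a) / (2 * pi * n)" "(d0 - a) / (2 * pi * n) < of_int (-j) + 1"
    unfolding j_def by linarith+
  then have "of_int (-j) * (2 * pi * n) \<le> d0 - a" "d0 - a < (of_int (-j) + 1) * (2 * pi * n)"
    using N by (simp_all only: pos_le_divide_eq pos_divide_less_eq)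
  then have d: "a \<le> d" "d < a + 2 * pi * n" by (auto simp: d_def algebra_simps)
  have w0: "w + Complex 0 (2 * pi * of_int k) = Complex (Re w) d0" by (simp add: complex_eq_iff d0_def b_def)
  have wd: "Complex (Re w) d0 + Complex 0 (2 * pi * n * of_int j) = Complex (Re w) d"
    by (simp add: complex_eq_iff d_def)
  have "Hs 1 (Complex (Re w) d) = y"
    using Hs_period[of "Complex (Re w) d0" 1 j] w(1) k unfolding w0 wd by simp
  then have yd: "asc (Re w) y d" using asc_Hs[of "Re w" 1 d] w(1) by simp
  have "d \<noteq> b"
    using not_reg[of w] w wb \<open>Hs 1 (Complex (Re w) d) = y\<close> by (auto simp: y_def)
  show ?thesis using d yb yd \<open>d \<noteq> b\<close> unfolding b_def by blast
qed

lemma pair_shrink: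
  assumes p: "asc r p a" "asc r p c" and r: "r < 0"
    and w: "Re w < 0" "a < Im w" "Im w < c" "\<not> reg w"
  shows "\<exists>t q a' c'. t < 0 \<and> min r (Re w) \<le> t \<and> asc t q a' \<and> asc t q c' \<and> a \<le> a' \<and> a' < c' \<and> c' \<le> c
    \<and> c' - a' < c - a"
proof -
  define b where "b = Im w"
  have b: "a < b" "b < c" using w by (auto simp: b_def)
  obtain y d where d: "a \<le> d" "d < a + 2 * pi * n" and "d \<noteq> b"
    and yb: "asc (Re w) y b" and yd: "asc (Re w) y d"
    using not_reg_pair[OF w(1,4), of a] unfolding b_def by blast
  consider "d \<le> c" "d < b" | "d \<le> c" "b < d" | "c < d" using \<open>d \<noteq> b\<close> by linarith
  then show ?thesis
  proof cases
    case 1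
    then show ?thesis using yb yd w b d
      by (rule_tac exI[of _ "Re w"], rule_tac exI[of _ y], rule_tac exI[of _ d], rule_tac exI[of _ b]) auto
  next
    case 2
    then show ?thesis using yb yd w b d
      by (rule_tac exI[of _ "Re w"], rule_tac exI[of _ y], rule_tac exI[of _ b], rule_tac exI[of _ d]) auto
  next
    case 3
    obtain t z where "t < 0" "min r (Re w) \<le> t" "asc t z b" "asc t z a \<or> asc t z c"
      using asc_cross[OF p yb yd r w(1) b 3 d(2)] by blast
    then show ?thesis
    proof (elim disjE)
      assume "asc t z a"
      with \<open>t < 0\<close> \<open>min r (Re w) \<le> t\<close> \<open>asc t z b\<close> b show ?thesis
        by (rule_tac exI[of _ t], rule_tac exI[of _ z], rule_tac exI[of _ a], rule_tac exI[of _ b]) auto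
    next
      assume "asc t z c"
      with \<open>t < 0\<close> \<open>min r (Re w) \<le> t\<close> \<open>asc t z b\<close> b show ?thesis
        by (rule_tac exI[of _ t], rule_tac exI[of _ z], rule_tac exI[of _ b], rule_tac exI[of _ c]) auto
    qed
  qed
qed

lemma pair_diff:
  assumes "asc r p a" "asc r p c" "a < c"
  shows "\<exists>m::nat. 0 < m \<and> c = a + 2 * pi * m"
proof -
  have "cis c = cis a" using asc_cis[OF assms(2,1)] by simp
  then obtain k :: int where k: "c = a + 2 * pi * k" unfolding cis_eq_cis_iff by blast
  then have "k > 0" using assms(3) by (simp add: zero_less_mult_iff)
  then show ?thesis using k by (intro exI[of _ "nat k"]) auto
qed

text \<open>The set \<open>U\<close> restricts the levels \<open>r = ln (cmod (f p))\<close> at which pairs may start. It is used with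
the whole line and with a half-line \<open>{L..}\<close>.\<close>

lemma minimal_pair:
  assumes up: "\<And>x t. x \<in> U \<Longrightarrow> x \<le> t \<Longrightarrow> t \<in> U"
    and p: "asc r p a" "asc r p c" "r < 0" "r \<in> U" "a < c"
  shows "\<exists>r p a' c'. asc r p a' \<and> asc r p c' \<and> r < 0 \<and> r \<in> U \<and> a \<le> a' \<and> a' < c' \<and> c' \<le> c \<and>
    (\<forall>w. Re w \<in> U \<longrightarrow> Re w < 0 \<longrightarrow> a' < Im w \<longrightarrow> Im w < c' \<longrightarrow> reg w)"
proof -
  obtain m :: nat where "c = a + 2 * pi * m" using pair_diff[OF p(1,2,5)] by blast
  then show ?thesis using p
  proof (induction m arbitrary: r p a c rule: less_induct)
    case (less m)
    show ?case
    proof (cases "\<forall>w. Re w \<in> U \<longrightarrow> Re w < 0 \<longrightarrow> a < Im w \<longrightarrow> Im w < c \<longrightarrow> reg w")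
      case True
      then show ?thesis using less.prems by (rule_tac exI[of _ r], rule_tac exI[of _ p], rule_tac exI[of _ a], rule_tac exI[of _ c]) auto
    next
      case False
      then obtain w where w: "Re w \<in> U" "Re w < 0" "a < Im w" "Im w < c" "\<not> reg w" by blast
      obtain t q a' c' where t: "t < 0" "min r (Re w) \<le> t" "asc t q a'" "asc t q c'" "a \<le> a'" "a' < c'" "c' \<le> c"
          "c' - a' < c - a"
        using pair_shrink[OF less.prems(2-4) w(2-5)] by blast
      have "t \<in> U" using up t(2) less.prems(5) w(1) by (metis min_def)
      obtain m' :: nat where m': "c' = a' + 2 * pi * m'" using pair_diff[OF t(3,4,6)] by blast
      have "m' < m" using t(8) m' less.prems(1) by simp
      from less.IH[OF this m' t(3,4,1) \<open>t \<in> U\<close> t(6)] t less.prems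
      obtain r2 p2 a2 c2 where "asc r2 p2 a2" "asc r2 p2 c2" "r2 < 0" "r2 \<in> U" "a' \<le> a2" "a2 < c2" "c2 \<le> c'"
        "\<forall>w. Re w \<in> U \<longrightarrow> Re w < 0 \<longrightarrow> a2 < Im w \<longrightarrow> Im w < c2 \<longrightarrow> reg w" by auto
      then show ?thesis using t by (rule_tac exI[of _ r2], rule_tac exI[of _ p2], rule_tac exI[of _ a2], rule_tac exI[of _ c2]) auto
    qed
  qed
qed

end

section \<open>Univalent branches of the inverse\<close>

lemma generic_point:
  assumes "open A" "A \<noteq> {}" "finite F"
  shows "\<exists>v\<in>A. v \<noteq> 0 \<and> sgn v \<notin> (F :: complex set)"
proof -
  obtain v0 where v0: "v0 \<in> A" "v0 \<noteq> 0"
  proof (cases "0 \<in> A")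
    case True
    then obtain e where e: "e > 0" "ball 0 e \<subseteq> A" using assms(1) open_contains_ball by blast
    have "complex_of_real (e/2) \<in> ball 0 e" using e(1) by simp
    then have "complex_of_real (e/2) \<in> A" using e by blast
    then show ?thesis using that[of "of_real (e/2)"] e(1) by simp
  qed (use assms(2) that in blast)
  define x where "x = Arg v0"
  have v0e: "v0 = of_real (cmod v0) * cis x" using v0(2) by (simp add: x_def Arg_eq cis_conv_exp)
  have "((\<lambda>y. of_real (cmod v0) * cis y) \<longlongrightarrow> of_real (cmod v0) * cis x) (at x)"
    by (intro tendsto_intros)
  then have "\<forall>\<^sub>F y in at x. of_real (cmod v0) * cis y \<in> A"
    by (rule topological_tendstoD) (use assms(1) v0(1) v0e in auto)
  moreover have "\<forall>\<^sub>F y in at x. cis y \<notin> F"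
    using finite_cis_avoid[OF assms(3), of x] unfolding eventually_at by auto
  ultimately have "\<forall>\<^sub>F y in at x. of_real (cmod v0) * cis y \<in> A \<and> cis y \<notin> F"
    by eventually_elim auto
  from eventually_happens'[OF _ this] obtain y where y: "of_real (cmod v0) * cis y \<in> A" "cis y \<notin> F" by auto
  moreover have "sgn (of_real (cmod v0) * cis y) = cis y"
    using v0(2) by (simp add: sgn_eq norm_mult)
  ultimately show ?thesis using v0(2) by (intro bexI[of _ "of_real (cmod v0) * cis y"]) auto
qed

context disc_map
begin

lemma reg_lim:
  assumes "Re w \<le> 0" "reg w"
  shows "(H \<longlongrightarrow> Hs 1 w) (at w within Gen)"
proof -
  obtain l where l: "(H \<longlongrightarrow> l) (at w within Gen)" using assms(2) by (auto simp: reg_def)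
  have "Hs 1 w = l" by (rule Hs_unique[OF assms(1) _ tendsto_within_subset[OF l side_Gen]]) simp
  with l show ?thesis by simp
qed

lemma Gen_nontrivial: "Re w \<le> 0 \<Longrightarrow> at w within Gen \<noteq> bot"
  using lim_nontrivial[of w 1] at_le[OF side_Gen[of 1 "Im w"], of w] by (auto simp: bot_unique)

lemma Hs_in_ball: "Re w < 0 \<Longrightarrow> Hs 1 w \<in> ball 0 1"
  using Hs_cball[of w 1] f_Hs[of w 1] norm_less[of "Hs 1 w"] cball_Om
  by (auto dest: subsetD[where c="Hs 1 w"])

text \<open>On an open set of regular points whose height is at most the period, \<open>H\<close> extends to a univalent
branch. Off the finitely many points over critical points it is locally an inverse of \<open>f\<close> composed
with the exponential, and those points are removable. Injectivity holds at points of noncritical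
argument and carries over to all points because the branch is open.\<close>

lemma extended_branch:
  assumes W: "open W" and neg: "\<And>w. w \<in> W \<Longrightarrow> Re w < 0" and rg: "\<And>w. w \<in> W \<Longrightarrow> reg w"
    and strip: "\<And>w. w \<in> W \<Longrightarrow> lo < Im w \<and> Im w < lo + 2 * pi * n"
  shows "Hs 1 holomorphic_on W" "inj_on (Hs 1) W" "Hs 1 ` W \<subseteq> ball 0 1"
    "\<And>w. w \<in> W \<Longrightarrow> f (Hs 1 w) = exp w"
proof -
  let ?h = "Hs 1"
  show fh: "f (?h w) = exp w" if "w \<in> W" for w using f_Hs[of w 1] neg[OF that] by simp
  show "?h ` W \<subseteq> ball 0 1" using Hs_in_ball neg by blast
  have ch: "continuous_on W ?h"
    by (rule continuous_on_limit_ext[where A=Gen and h=H])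
      (use neg rg reg_lim Gen_nontrivial in \<open>auto simp: less_imp_le\<close>)
  define K where "K = {w\<in>W. deriv f (?h w) = 0}"
  have "K \<subseteq> (\<Union>c\<in>{c\<in>Crit. f c \<noteq> 0}. {w\<in>cbox (Complex (ln (cmod (f c))) lo) (Complex (ln (cmod (f c))) (lo + 2 * pi * n)).
      exp w - f c = 0})"
  proof
    fix w assume w: "w \<in> K"
    then have "?h w \<in> Crit" "f (?h w) = exp w" using Hs_in_ball[OF neg, of w] fh by (auto simp: K_def Crit_def)
    moreover have "w \<in> cbox (Complex (ln (cmod (exp w))) lo) (Complex (ln (cmod (exp w))) (lo + 2 * pi * n))"
      using strip[of w] w by (auto simp: K_def in_cbox_complex_iff)
    ultimately show "w \<in> (\<Union>c\<in>{c\<in>Crit. f c \<noteq> 0}. {w\<in>cbox (Complex (ln (cmod (f c))) lo) (Complex (ln (cmod (f c))) (lo + 2 * pi * n)).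
      exp w - f c = 0})"
      by (intro UN_I[of "?h w"]) auto
  qed
  moreover have "finite {w\<in>cbox p q. exp w - v = 0}" for p q v :: complex
  proof (rule holomorphic_compact_finite_zeros[of _ UNIV])
    show "\<not> (\<lambda>w. exp w - v) constant_on UNIV"
    proof
      assume "(\<lambda>w. exp w - v) constant_on UNIV"
      then have "exp 0 - v = exp (of_real 1) - v" unfolding constant_on_def by (metis UNIV_I)
      then have "complex_of_real (exp 1) = of_real 1" by (simp flip: exp_of_real)
      then have "exp (1::real) = 1" by (simp only: of_real_eq_iff)
      then show False using exp_gt_one[of 1] by simp
    qed
  qed (auto intro!: holomorphic_intros)
  ultimately have "finite K" using finite_Crit by (auto intro: finite_subset)
  have "?h field_differentiable at w" if w: "w \<in> W - K" for w
  proof -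
    have "?h w \<in> Om" "deriv f (?h w) \<noteq> 0"
      using w Hs_in_ball[OF neg, of w] cball_Om by (auto simp: K_def dest: subsetD[where c="?h w"])
    then obtain r where r: "r > 0" "ball (?h w) r \<subseteq> Om" "inj_on f (ball (?h w) r)"
      using has_complex_derivative_locally_injective[OF holf _ open_Om] by metis
    obtain g where g: "g holomorphic_on (f ` ball (?h w) r)" "\<And>x. x \<in> ball (?h w) r \<Longrightarrow> g (f x) = x"
      using holomorphic_has_inverse[OF holomorphic_on_subset[OF holf r(2)] open_ball r(3)] by metis
    define W' where "W' = W \<inter> ?h -` ball (?h w) r"
    have "open W'" unfolding W'_def by (rule continuous_open_preimage[OF ch W open_ball])
    have eq: "g (exp u) = ?h u" if "u \<in> W'" for u
      using g(2)[of "?h u"] fh[of u] that by (auto simp: W'_def)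
    have "(g \<circ> exp) holomorphic_on W'"
      by (rule holomorphic_on_compose_gen[OF _ g(1)])
        (auto intro!: holomorphic_intros simp: W'_def fh[symmetric])
    then have "?h holomorphic_on W'" by (rule holomorphic_transform) (simp add: eq)
    then show ?thesis using \<open>open W'\<close> w r(1) by (auto simp: holomorphic_on_open W'_def field_differentiable_def)
  qed
  then have "?h holomorphic_on (W - K)"
    by (auto simp: holomorphic_on_def intro: field_differentiable_at_within)
  then show hh: "?h holomorphic_on W" by (rule no_isolated_singularity[OF ch _ W \<open>finite K\<close>])
  show "inj_on ?h W"
  proof (rule inj_onI, rule ccontr)
    fix w1 w2 assume w: "w1 \<in> W" "w2 \<in> W" "?h w1 = ?h w2" "w1 \<noteq> w2"
    obtain r1 where r1: "r1 > 0" "ball w1 r1 \<subseteq> W" using W w(1) open_contains_ball by blast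
    obtain r2 where r2: "r2 > 0" "ball w2 r2 \<subseteq> W" using W w(2) open_contains_ball by blast
    define r where "r = min (min r1 r2) (dist w1 w2 / 2)"
    have r: "r > 0" using r1 r2 w(4) by (simp add: r_def)
    have sub: "ball w1 r \<subseteq> W" "ball w2 r \<subseteq> W" using r1 r2 by (auto simp: r_def)
    have dj: "ball w1 r \<inter> ball w2 r = {}" by (rule disjoint_ballI) (simp add: r_def)
    have op: "open (?h ` ball u r)" if "ball u r \<subseteq> W" for u
    proof (rule open_mapping_thm[OF holomorphic_on_subset[OF hh that] open_ball connected_ball open_ball order_refl])
      show "\<not> ?h constant_on ball u r"
      proof
        assume "?h constant_on ball u r"
        moreover have "u \<in> ball u r" "u + of_real (r/2) \<in> ball u r" using r by (auto simp: dist_norm)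
        ultimately have "?h u = ?h (u + of_real (r/2))" "u \<in> W" "u + of_real (r/2) \<in> W"
          using that unfolding constant_on_def by (metis, blast+)
        then have "exp u = exp (u + of_real (r/2))" using fh by metis
        then have "cmod (exp u) = cmod (exp (u + of_real (r/2)))" by simp
        then show False using r by simp
      qed
    qed
    define A where "A = ?h ` ball w1 r \<inter> ?h ` ball w2 r"
    have "open A" unfolding A_def using op sub by blast
    have "?h w1 \<in> ?h ` ball w1 r" "?h w2 \<in> ?h ` ball w2 r" using r by simp_all
    then have "?h w1 \<in> A" unfolding A_def using w(3) by simp
    then have "exp w1 \<in> f ` A" using fh[OF w(1)] by (auto intro!: image_eqI[of _ f "?h w1"])
    have "A \<subseteq> ball 0 1" unfolding A_def using Hs_in_ball neg sub by blast
    then have "A \<subseteq> Om" using cball_Om ball_subset_cball by blast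
    have "open (f ` A)" by (rule f_open_map[OF \<open>open A\<close> \<open>A \<subseteq> Om\<close>])
    then obtain v where v: "v \<in> f ` A" "v \<noteq> 0" "sgn v \<notin> Args"
      using generic_point[OF _ _ finite_Args] \<open>exp w1 \<in> f ` A\<close> by (metis empty_iff)
    obtain y where y: "y \<in> A" "f y = v" using v(1) by blast
    obtain u1 where u1: "u1 \<in> ball w1 r" "?h u1 = y" using y by (auto simp: A_def)
    obtain u2 where u2: "u2 \<in> ball w2 r" "?h u2 = y" using y by (auto simp: A_def)
    have uW: "u1 \<in> W" "u2 \<in> W" using u1 u2 sub by auto
    have "exp u1 = v" "exp u2 = v" using fh uW u1 u2 y by metis+
    then have "cis (Im u1) \<notin> Args" "cis (Im u2) \<notin> Args" using v(3) by (metis sgn_exp_complex)+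
    then have c: "u1 \<in> comb" "u2 \<in> comb" using neg uW by (auto simp: comb_def less_imp_le)
    then have "H u1 = H u2" using u1 u2 Hs_comb[of _ 1] by simp
    then obtain k :: int where k: "u1 = u2 + Complex 0 (2 * pi * n * of_int k)" using H_eqD c by blast
    then have "Im u1 - Im u2 = (2 * pi * n) * of_int k" by simp
    moreover have "\<bar>Im u1 - Im u2\<bar> < (2 * pi * n) * 1" using strip[OF uW(1)] strip[OF uW(2)] by auto
    ultimately have "(2 * pi * n) * \<bar>of_int k\<bar> < (2 * pi * n) * 1" by (simp add: abs_mult)
    moreover have "2 * pi * n > 0" using n_pos by simp
    ultimately have "\<bar>real_of_int k\<bar> < 1" using mult_less_cancel_left_pos by blast
    then have "k = 0" by linarith
    then have "u1 = u2" using k by (simp add: complex_eq_iff)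
    then show False using u1 u2 dj by blast
  qed
qed

lemma ascent_H: "w \<in> comb \<Longrightarrow> ascent (Re w) (H w) (Im w) (\<lambda>t. H (Complex t (Im w)))"
proof -
  assume w: "w \<in> comb"
  have "Complex t (Im w) \<in> comb" if "Re w \<le> t" "t \<le> 0" for t
    using comb_up[of "Re w" "Im w" t] that w by simp
  then show ?thesis unfolding ascent_def
    using w H_line_cont[of "Re w" "Im w"] H_cball f_H by (auto simp: H_imag comb_def)
qed

text \<open>Let \<open>\<Gamma>\<close> be the union of two ascents of a point to boundary labels at distance exactly \<open>2 pi\<close>. The
component \<open>U\<close> of its complement next to the boundary arc between the labels contains only one point
over each value of noncritical argument, since any other such point would be joined in \<open>U\<close> with a
boundary point outside the arc. So \<open>f\<close> is injective on \<open>U\<close>, and by properness its image contains the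
disc without the radial slit covered by \<open>\<Gamma>\<close>.\<close>

lemma slit_branch:
  assumes p: "asc r p x" "asc r p (x + 2 * pi)" and r: "r < 0"
  defines "Sl \<equiv> {v \<in> ball 0 1. \<not> (v = of_real (cmod v) * cis x \<and> exp r \<le> cmod v)}"
  shows "\<exists>h. h holomorphic_on Sl \<and> inj_on h Sl \<and> h ` Sl \<subseteq> ball 0 1 \<and> (\<forall>v\<in>Sl. f (h v) = v)"
proof -
  obtain s1 s2 where s: "ascent r p x s1" "ascent r p (x + 2 * pi) s2" using p by (auto simp: asc_def)
  define \<Gamma> where "\<Gamma> = s1 ` {r..0} \<union> s2 ` {r..0}"
  have "compact \<Gamma>" unfolding \<Gamma>_def using s
    by (intro compact_Un compact_continuous_image) (auto simp: ascent_def)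
  have cx: "cis (x + 2 * pi) = cis x" using cis_period[of x 1] by simp
  have f\<Gamma>: "\<exists>t\<in>{r..0}. f z = exp (Complex t x)" if "z \<in> \<Gamma>" for z
    using that s exp_Complex_cong[OF cx] unfolding \<Gamma>_def ascent_def by auto
  have \<Gamma>Sl: "f z \<notin> Sl" if "z \<in> \<Gamma>" for z
    using f\<Gamma>[OF that] by (auto simp: Sl_def exp_eq_polar norm_mult)
  define D where "D = ball 0 1 - \<Gamma>"
  have "open D" unfolding D_def using \<open>compact \<Gamma>\<close> compact_imp_closed by (intro open_Diff) auto
  define x0 where "x0 = ln Rad / 2"
  have x0: "ln Rad < x0" "x0 < 0" using Rad by (auto simp: x0_def)
  define w0 where "w0 = Complex x0 (x + pi)"
  define T where "T = {w\<in>comb. Re w < 0 \<and> x < Im w \<and> Im w < x + 2 * pi}"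
  have w0: "w0 \<in> T" using x0 pi_gt_zero by (simp add: T_def w0_def comb_def)
  have cisne: "cis y \<noteq> cis x" if "x < y" "y < x + 2 * pi" for y
  proof
    assume "cis y = cis x"
    then obtain k :: int where k: "y = x + 2 * pi * k" unfolding cis_eq_cis_iff by blast
    then have "2 * pi * 0 < 2 * pi * real_of_int k" "2 * pi * real_of_int k < 2 * pi * 1" using that by simp_all
    then have "(0::real) < real_of_int k" "real_of_int k < 1"
      using mult_less_cancel_left_pos[of "2*pi" 0 "real_of_int k"] mult_less_cancel_left_pos[of "2*pi" "real_of_int k" 1] pi_gt_zero
      by (simp_all only: mult_pos_pos zero_less_numeral)
    then show False by simp
  qed
  have avoid: "H w \<notin> \<Gamma>" if "w \<in> comb" "cis (Im w) \<noteq> cis x" for w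
  proof
    assume "H w \<in> \<Gamma>"
    then have "\<exists>t. exp w = exp (Complex t x)" using f\<Gamma> f_H[OF that(1)] by metis
    then obtain t where "exp w = exp (Complex t x)" by blast
    then have "cis (Im w) = cis x" by (metis sgn_exp_complex complex.sel(2))
    with that show False by simp
  qed
  have Hball: "H w \<in> ball 0 1" if "w \<in> comb" "Re w < 0" for w
    using Hs_in_ball[of w] Hs_comb[of w 1] that by simp
  have HD: "H w \<in> D" if "w \<in> T" for w
    using that avoid[of w] cisne[of "Im w"] Hball[of w] by (auto simp: T_def D_def)
  define U where "U = connected_component_set D (H w0)"
  have "open U" unfolding U_def by (rule open_connected_component[OF \<open>open D\<close>])
  have "U \<subseteq> D" unfolding U_def by (rule connected_component_subset)
  have "connected U" unfolding U_def by simp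
  have U_max: "A \<subseteq> U" if "connected A" "A \<subseteq> D" "z \<in> A" "z \<in> U" for A z
  proof -
    have "connected (U \<union> A)" by (rule connected_Un) (use \<open>connected U\<close> that in auto)
    moreover have "H w0 \<in> U" unfolding U_def using HD[OF w0] by simp
    ultimately show ?thesis
      using connected_component_maximal[of "H w0" "U \<union> A" D] \<open>U \<subseteq> D\<close> that unfolding U_def by auto
  qed
  have H0U: "H w0 \<in> U" unfolding U_def using HD[OF w0] by simp
  have HTU: "H w \<in> U" if w: "w \<in> T" for w
  proof -
    define w1 where "w1 = Complex x0 (Im w)"
    have "closed_segment w w1 \<union> closed_segment w1 w0 \<subseteq> T"
    proof
      fix u assume "u \<in> closed_segment w w1 \<union> closed_segment w1 w0"
      then show "u \<in> T"
      proof
        assume "u \<in> closed_segment w w1"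
        then obtain t where t: "0 \<le> t" "t \<le> 1" "u = (1 - t) *\<^sub>R w + t *\<^sub>R w1"
          by (auto simp: closed_segment_def)
        have im: "Im u = Im w" by (simp add: t w1_def algebra_simps)
        have re: "Re u = (1 - t) * Re w + t * x0" by (simp add: t w1_def)
        have "(1 - t) * Re w + t * x0 < 0"
          using convex_bound_lt[of "Re w" 0 x0 "1-t" t] w x0 t by (simp add: T_def)
        moreover have "ln Rad < (1 - t) * Re w + t * x0" if "ln Rad < Re w"
          using convex_bound_lt[of "- Re w" "- ln Rad" "- x0" "1-t" t] that x0 t by simp
        ultimately show ?thesis using w by (auto simp: T_def comb_def im re)
      next
        assume "u \<in> closed_segment w1 w0"
        then obtain t where t: "0 \<le> t" "t \<le> 1" "u = (1 - t) *\<^sub>R w1 + t *\<^sub>R w0"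
          by (auto simp: closed_segment_def)
        have re: "Re u = x0" by (simp add: t w1_def w0_def algebra_simps)
        have im: "Im u = (1 - t) * Im w + t * (x + pi)" by (simp add: t w1_def w0_def)
        have "(1 - t) * Im w + t * (x + pi) < x + 2 * pi"
          using convex_bound_lt[of "Im w" "x + 2 * pi" "x + pi" "1-t" t] w t by (simp add: T_def)
        moreover have "x < (1 - t) * Im w + t * (x + pi)"
          using convex_bound_lt[of "- Im w" "- x" "- (x + pi)" "1-t" t] w t by (simp add: T_def algebra_simps)
        ultimately show ?thesis using x0 by (simp add: T_def comb_def im re)
      qed
    qed
    moreover have "connected (closed_segment w w1 \<union> closed_segment w1 w0)"
      by (intro connected_Un connected_segment) auto
    moreover have "T \<subseteq> comb" by (auto simp: T_def)
    ultimately have "connected (H ` (closed_segment w w1 \<union> closed_segment w1 w0))"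
      by (intro connected_continuous_image continuous_on_subset[OF H_cont]) auto
    from U_max[OF this _ _ H0U] \<open>closed_segment w w1 \<union> closed_segment w1 w0 \<subseteq> T\<close>
    show ?thesis using HD by (auto simp: image_subset_iff)
  qed
  have below: "\<exists>w'\<in>T. z = H w' \<and> Re w' = Re w"
    if z: "z \<in> U" "f z = exp w" and w: "w \<in> comb" "Re w < 0" "cis (Im w) \<noteq> cis x" for z w
  proof -
    have "z \<in> ball 0 1" using z(1) \<open>U \<subseteq> D\<close> by (auto simp: D_def)
    then obtain k0 :: int where k0: "z = H (w + Complex 0 (2 * pi * of_int k0))"
      using H_onto[of z w] z w by auto
    define y0 where "y0 = Im w + 2 * pi * of_int k0"
    define j where "j = - \<lfloor>(y0 - x) / (2 * pi * n)\<rfloor>"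
    define y where "y = y0 + 2 * pi * n * of_int j"
    have N: "2 * pi * n > 0" using n_pos by simp
    have "of_int (-j) \<le> (y0 - x) / (2 * pi * n)" "(y0 - x) / (2 * pi * n) < of_int (-j) + 1"
      unfolding j_def by linarith+
    then have "of_int (-j) * (2 * pi * n) \<le> y0 - x" "y0 - x < (of_int (-j) + 1) * (2 * pi * n)"
      using N by (simp_all only: pos_le_divide_eq pos_divide_less_eq)
    then have y: "x \<le> y" "y < x + 2 * pi * n" by (auto simp: y_def algebra_simps)
    have cy: "cis y = cis (Im w)"
      unfolding y_def y0_def by (simp only: cis_period_n cis_period)
    define w1 where "w1 = Complex (Re w) y"
    have w1c: "w1 \<in> comb" using w cy by (simp add: comb_def w1_def)
    have eq1: "w1 = (w + Complex 0 (2 * pi * of_int k0)) + Complex 0 (2 * pi * n * of_int j)"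
      by (simp add: w1_def y_def y0_def complex_eq_iff)
    have zH: "z = H w1"
      unfolding eq1 using H_period[of "w + Complex 0 (2 * pi * of_int k0)" j] k0 w(1) by (simp add: comb_shift)
    have "y \<noteq> x" "y \<noteq> x + 2 * pi" using cy w(3) cx by auto
    have "y < x + 2 * pi"
    proof (rule ccontr)
      assume "\<not> y < x + 2 * pi"
      then have y2: "x + 2 * pi < y" using \<open>y \<noteq> x + 2 * pi\<close> by simp
      obtain g where g: "path g" "pathstart g = zeta x" "pathfinish g = zeta (x + 2 * pi)" "path_image g = \<Gamma>"
        using ascent_pair_path[OF s] by (auto simp: \<Gamma>_def)
      have w0c: "w0 \<in> comb" using w0 by (simp add: T_def)
      obtain h1 where h1: "path h1" "pathstart h1 = H w0" "pathfinish h1 = zeta (x + pi)"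
          "path_image h1 = (\<lambda>t. H (Complex t (x + pi))) ` {x0..0}"
        using ascent_path[OF ascent_H[OF w0c]] by (auto simp: w0_def)
      obtain h2 where h2: "path h2" "pathstart h2 = H w1" "pathfinish h2 = zeta y"
          "path_image h2 = (\<lambda>t. H (Complex t y)) ` {Re w..0}"
        using ascent_path[OF ascent_H[OF w1c]] by (auto simp: w1_def)
      have "path_connected U" using \<open>open U\<close> \<open>connected U\<close> connected_open_path_connected by blast
      then obtain h3 where h3: "path h3" "path_image h3 \<subseteq> U" "pathstart h3 = H w0" "pathfinish h3 = H w1"
        using H0U z(1) zH unfolding path_connected_def by metis
      \<comment> \<open>from the boundary arc through \<open>U\<close> and out to a label beyond the arc, without meeting \<open>\<Gamma>\<close>\<close>
      define h where "h = (reversepath h1 +++ h3) +++ h2"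
      have hp: "path h" "pathstart h = zeta (x + pi)" "pathfinish h = zeta y"
        unfolding h_def using h1 h2 h3 by simp_all
      have him: "path_image h = path_image h1 \<union> path_image h3 \<union> path_image h2"
        unfolding h_def using h1 h2 h3 by (simp add: path_image_join)
      have i1: "path_image h1 \<subseteq> ball 0 1 \<union> {zeta (x + pi)}"
        using ascent_image[OF ascent_H[OF w0c]] unfolding h1(4) by (simp add: w0_def)
      have i2: "path_image h2 \<subseteq> ball 0 1 \<union> {zeta y}"
        using ascent_image[OF ascent_H[OF w1c]] unfolding h2(4) by (simp add: w1_def)
      have i3: "path_image h3 \<subseteq> ball 0 1" using h3(2) \<open>U \<subseteq> D\<close> by (auto simp: D_def)
      have "\<exists>q. q \<in> path_image g \<and> q \<in> path_image h"
      proof (rule zeta_paths_cross[OF g(1) _ g(2,3) hp(1) _ hp(2,3)])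
        show "path_image g \<subseteq> ball 0 1 \<union> {zeta x, zeta (x + 2 * pi)}"
          using ascent_image[OF s(1)] ascent_image[OF s(2)] unfolding g(4) \<Gamma>_def by blast
        show "path_image h \<subseteq> ball 0 1 \<union> {zeta (x + pi), zeta y}" unfolding him using i1 i2 i3 by blast
      qed (use y y2 pi_gt_zero in auto)
      then obtain q where q: "q \<in> \<Gamma>" "q \<in> path_image h1 \<union> path_image h3 \<union> path_image h2"
        unfolding g(4) him by blast
      have "q \<notin> path_image h3" using q(1) h3(2) \<open>U \<subseteq> D\<close> by (auto simp: D_def)
      then obtain t b where tb: "q = H (Complex t b)" "Complex t b \<in> comb" "cis b \<noteq> cis x"
      proof -
        assume a: thesis if "q = H (Complex t b)" "Complex t b \<in> comb" "cis b \<noteq> cis x" for t b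
        from \<open>q \<notin> path_image h3\<close> q(2) consider "q \<in> path_image h1" | "q \<in> path_image h2" by blast
        then show thesis
        proof cases
          case 1
          then obtain t where t: "t \<in> {x0..0}" "q = H (Complex t (x + pi))" unfolding h1(4) by blast
          then have "Complex t (x + pi) \<in> comb" using x0 by (simp add: comb_def)
          then show ?thesis using a t cisne[of "x + pi"] pi_gt_zero by simp
        next
          case 2
          then obtain t where t: "t \<in> {Re w..0}" "q = H (Complex t y)" unfolding h2(4) by blast
          then have "Complex t y \<in> comb" using comb_up[of "Re w" y t] w1c by (simp add: w1_def)
          then show ?thesis using a t cy w(3) by simp
        qed
      qed
      then show False using avoid[of "Complex t b"] q(1) by simp
    qed
    then have "w1 \<in> T" using y \<open>y \<noteq> x\<close> w1c w(2) by (simp add: T_def w1_def)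
    then show ?thesis using zH by (intro bexI[of _ w1]) (simp_all add: w1_def)
  qed
  have UOm: "U \<subseteq> Om" using \<open>U \<subseteq> D\<close> cball_Om ball_subset_cball unfolding D_def by blast
  have inj: "inj_on f U"
  proof (rule inj_onI, rule ccontr)
    fix u1 u2 assume u: "u1 \<in> U" "u2 \<in> U" "f u1 = f u2" "u1 \<noteq> u2"
    obtain r1 where r1: "r1 > 0" "ball u1 r1 \<subseteq> U" using \<open>open U\<close> u(1) open_contains_ball by blast
    obtain r2 where r2: "r2 > 0" "ball u2 r2 \<subseteq> U" using \<open>open U\<close> u(2) open_contains_ball by blast
    define e where "e = min (min r1 r2) (dist u1 u2 / 2)"
    have e: "e > 0" using r1 r2 u(4) by (simp add: e_def)
    have sub: "ball u1 e \<subseteq> U" "ball u2 e \<subseteq> U" using r1 r2 by (auto simp: e_def)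
    have dj: "ball u1 e \<inter> ball u2 e = {}" by (rule disjoint_ballI) (simp add: e_def)
    define A where "A = f ` ball u1 e \<inter> f ` ball u2 e"
    have "open A" unfolding A_def using sub UOm by (intro open_Int f_open_map open_ball) auto
    have "f u1 \<in> f ` ball u1 e" "f u2 \<in> f ` ball u2 e" using e by simp_all
    then have "f u1 \<in> A" unfolding A_def using u(3) by simp
    then obtain v where v: "v \<in> A" "v \<noteq> 0" "sgn v \<notin> insert (cis x) Args"
      using generic_point[OF \<open>open A\<close> _ finite.insertI[OF finite_Args]] by (metis empty_iff)
    obtain z1 where z1: "z1 \<in> ball u1 e" "f z1 = v" using v(1) by (auto simp: A_def)
    obtain z2 where z2: "z2 \<in> ball u2 e" "f z2 = v" using v(1) by (auto simp: A_def)
    define w where "w = Ln v"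
    have ew: "exp w = v" using v(2) by (simp add: w_def)
    have "z1 \<in> ball 0 1" using z1(1) sub(1) \<open>U \<subseteq> D\<close> unfolding D_def by blast
    then have "cmod (exp w) < 1" using f_ball z1 ew by auto
    then have "Re w < 0" by simp
    have cw: "cis (Im w) \<notin> Args" "cis (Im w) \<noteq> cis x" using v(3) sgn_exp_complex[of w] ew by auto
    then have wc: "w \<in> comb" using \<open>Re w < 0\<close> by (simp add: comb_def)
    have zU: "z1 \<in> U" "f z1 = exp w" "z2 \<in> U" "f z2 = exp w" using z1 z2 sub ew by auto
    obtain a where a: "a \<in> T" "z1 = H a" "Re a = Re w"
      using below[OF zU(1,2) wc \<open>Re w < 0\<close> cw(2)] by blast
    obtain b where b: "b \<in> T" "z2 = H b" "Re b = Re w"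
      using below[OF zU(3,4) wc \<open>Re w < 0\<close> cw(2)] by blast
    have "exp a = exp b" using f_H[of a] f_H[of b] a b z1 z2 by (simp add: T_def)
    then have "cis (Im a) = cis (Im b)" by (metis sgn_exp_complex)
    then obtain k :: int where k: "Im a = Im b + 2 * pi * k" unfolding cis_eq_cis_iff by blast
    moreover have "\<bar>Im a - Im b\<bar> < 2 * pi * 1" using a b by (auto simp: T_def)
    ultimately have "2 * pi * \<bar>of_int k\<bar> < 2 * pi * 1" by (simp add: abs_mult)
    then have "\<bar>real_of_int k\<bar> < 1" using mult_less_cancel_left_pos[of "2*pi"] pi_gt_zero by simp
    then have "k = 0" by linarith
    then have "a = b" using k a b by (simp add: complex_eq_iff)
    then show False using a b z1 z2 dj by auto
  qed
  have fU: "open (f ` U)" by (rule f_open_map[OF \<open>open U\<close> UOm])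
  have Sl_sub: "Sl \<subseteq> f ` U"
  proof -
    have "U \<subseteq> cball 0 1" using \<open>U \<subseteq> D\<close> by (auto simp: D_def)
    then have clU: "closure U \<subseteq> cball 0 1" by (simp add: closure_minimal)
    then have "compact (closure U)" using bounded_subset bounded_cball by (auto simp: compact_eq_bounded_closed)
    then have "closed (f ` closure U)"
      using clU by (intro compact_imp_closed compact_continuous_image continuous_on_subset[OF contf_cball]) auto
    have img_back: "v \<in> f ` U" if v: "v \<in> Sl" "v \<in> f ` closure U" for v
    proof -
      obtain z where z: "z \<in> closure U" "v = f z" using v by blast
      then have "z \<in> ball 0 1" using v(1) clU norm_less[of z] cball_Om by (auto simp: Sl_def)
      moreover have "z \<notin> \<Gamma>" using \<Gamma>Sl[of z] v(1) z(2) by auto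
      ultimately have "z \<in> D" by (simp add: D_def)
      then obtain e where e: "e > 0" "ball z e \<subseteq> D" using \<open>open D\<close> open_contains_ball by blast
      obtain z' where z': "z' \<in> U" "dist z' z < e" using z(1) e(1) closure_approachable by blast
      have "ball z e \<subseteq> U" by (rule U_max[OF connected_ball e(2) _ z'(1)]) (use z' in \<open>simp add: dist_commute\<close>)
      then have "z \<in> U" using e(1) by auto
      then show ?thesis using z(2) by blast
    qed
    have "open {v. \<not> (v = of_real (cmod v) * cis x \<and> exp r \<le> cmod v)}"
    proof -
      have "closed {v. v = of_real (cmod v) * cis x \<and> exp r \<le> cmod v}"
        by (intro closed_Collect_conj closed_Collect_eq closed_Collect_le continuous_intros)
      then show ?thesis by (simp add: open_closed Compl_eq Collect_neg_eq[symmetric])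
    qed
    then have "open (ball 0 1 \<inter> {v. \<not> (v = of_real (cmod v) * cis x \<and> exp r \<le> cmod v)})"
      by (rule open_Int[OF open_ball])
    moreover have "ball 0 1 \<inter> {v. \<not> (v = of_real (cmod v) * cis x \<and> exp r \<le> cmod v)} = Sl"
      unfolding Sl_def by blast
    ultimately have "open Sl" by simp
    have "connected Sl"
    proof (rule starlike_imp_connected)
      have "0 \<in> Sl" by (simp add: Sl_def)
      moreover have "closed_segment 0 v \<subseteq> Sl" if v: "v \<in> Sl" for v
      proof
        fix u assume "u \<in> closed_segment 0 v"
        then obtain t where t: "0 \<le> t" "t \<le> 1" "u = t *\<^sub>R v" by (auto simp: closed_segment_def)
        have nu: "cmod u = t * cmod v" using t by simp
        have le: "t * cmod v \<le> cmod v" using t by (simp add: mult_left_le_one_le)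
        have "cmod u < 1" using nu le v by (simp add: Sl_def)
        moreover have False if "u = of_real (cmod u) * cis x" "exp r \<le> cmod u"
        proof -
          have "t \<noteq> 0" using that(2) nu by auto
          have "of_real t * v = of_real t * (of_real (cmod v) * cis x)"
          proof -
            have "t *\<^sub>R v = of_real (t * cmod v) * cis x" using that(1) nu t(3) by metis
            then show ?thesis by (simp add: scaleR_conv_of_real)
          qed
          then have "v = of_real (cmod v) * cis x" using \<open>t \<noteq> 0\<close> by simp
          moreover have "exp r \<le> cmod v" using that(2) nu le by simp
          ultimately show False using v by (simp add: Sl_def)
        qed
        ultimately show "u \<in> Sl" by (auto simp: Sl_def)
      qed
      ultimately show "starlike Sl" unfolding starlike_def by blast
    qed
    \<comment> \<open>\<open>f ` U\<close> and \<open>B\<close> would separate the connected set \<open>Sl\<close>\<close>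
    define B where "B = Sl - f ` closure U"
    have "open B" unfolding B_def using \<open>open Sl\<close> \<open>closed (f ` closure U)\<close> by (rule open_Diff)
    have "f ` U \<inter> B \<inter> Sl = {}" using closure_subset unfolding B_def by blast
    moreover have "Sl \<subseteq> f ` U \<union> B" unfolding B_def using img_back by blast
    moreover have "f (H w0) \<in> f ` U \<inter> Sl"
    proof -
      have w0c: "w0 \<in> comb" "Re w0 < 0" using w0 by (auto simp: T_def)
      have "cis (x + pi) \<noteq> cis x" using cisne[of "x + pi"] pi_gt_zero by simp
      then have "exp w0 \<in> Sl" using w0c by (simp add: Sl_def exp_eq_polar norm_mult w0_def)
      then show ?thesis using imageI[OF H0U, of f] f_H[OF w0c(1)] by simp
    qed
    ultimately have "B \<inter> Sl = {}" using connectedD[OF \<open>connected Sl\<close> fU \<open>open B\<close>] by blast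
    then show ?thesis using \<open>Sl \<subseteq> f ` U \<union> B\<close> by blast
  qed
  obtain h where h: "h holomorphic_on (f ` U)" "\<And>z. z \<in> U \<Longrightarrow> h (f z) = z"
    using holomorphic_has_inverse[OF holomorphic_on_subset[OF holf UOm] \<open>open U\<close> inj] by metis
  have fh: "f (h v) = v \<and> h v \<in> U" if "v \<in> Sl" for v using Sl_sub that h(2) by fastforce
  show ?thesis
  proof (intro exI[of _ h] conjI ballI)
    show "h holomorphic_on Sl" by (rule holomorphic_on_subset[OF h(1) Sl_sub])
    show "inj_on h Sl" by (rule inj_onI) (metis fh)
    show "h ` Sl \<subseteq> ball 0 1" using fh \<open>U \<subseteq> D\<close> by (auto simp: D_def)
  qed (use fh in blast)
qed

end

section \<open>The three surfaces\<close>

lemma open_G_dom: "open (G_dom a)"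
  unfolding G_dom_def
  by (intro open_Un open_Collect_conj open_Collect_less continuous_intros)

lemma cnj_image: "cnj ` A = {w. cnj w \<in> A}"
proof (intro equalityI subsetI)
  fix w assume "w \<in> {w. cnj w \<in> A}"
  then show "w \<in> cnj ` A" by (intro image_eqI[of w cnj "cnj w"]) auto
qed auto

lemma G_dom_refl_alt:
  "G_dom_refl a = {w. Re w < 0 \<and> -2 * pi < Im w \<and> Im w < 0}
           \<union> {w. ln a < Re w \<and> Re w < 0 \<and> -3 * pi < Im w \<and> Im w < 0}"
  unfolding G_dom_refl_def cnj_image G_dom_def by auto

lemma open_G_dom_refl: "open (G_dom_refl a)"
  unfolding G_dom_refl_alt
  by (intro open_Un open_Collect_conj open_Collect_less continuous_intros)

context disc_map
begin

text \<open>The strip condition only bounds the height of \<open>W\<close>; \<open>x\<close> is the rotation angle.\<close>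

lemma translated_branch:
  assumes W: "open W" and neg: "\<And>w. w \<in> W \<Longrightarrow> Re w < 0"
    and rg: "\<And>w. w \<in> W \<Longrightarrow> reg (w + Complex 0 x)"
    and strip: "\<And>w. w \<in> W \<Longrightarrow> lo < Im w \<and> Im w < lo + 2 * pi * n"
  shows "surface_contains f unit_disk (rotate_surface x exp) W"
proof -
  define V where "V = (\<lambda>w. Complex 0 x + w) ` W"
  have V: "open V" unfolding V_def by (rule open_translation[OF W])
  have br: "Hs 1 holomorphic_on V" "inj_on (Hs 1) V" "Hs 1 ` V \<subseteq> ball 0 1"
    "\<And>w. w \<in> V \<Longrightarrow> f (Hs 1 w) = exp w"
    by (rule extended_branch[OF V, of "lo + x"];
        use neg rg strip in \<open>force simp: V_def add.commute\<close>)+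
  let ?h = "\<lambda>w. Hs 1 (Complex 0 x + w)"
  have "(Hs 1 \<circ> (\<lambda>w. Complex 0 x + w)) holomorphic_on W"
    by (rule holomorphic_on_compose_gen[OF _ br(1)]) (auto intro!: holomorphic_intros simp: V_def)
  then have "?h holomorphic_on W" by (simp add: o_def)
  moreover have "inj_on ?h W"
  proof (rule inj_onI)
    fix u v assume "u \<in> W" "v \<in> W" "?h u = ?h v"
    then show "u = v" using inj_onD[OF br(2), of "Complex 0 x + u" "Complex 0 x + v"] by (simp add: V_def)
  qed
  moreover have "?h ` W \<subseteq> unit_disk" using br(3) by (auto simp: V_def image_subset_iff)
  moreover have "f (?h w) = rotate_surface x exp w" if "w \<in> W" for w
  proof -
    have "f (?h w) = exp (Complex 0 x + w)" by (rule br(4)) (use that in \<open>simp add: V_def\<close>)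
    also have "\<dots> = exp (\<i> * of_real x + w)"
      by (rule arg_cong[of _ _ exp]) (simp add: complex_eq_iff)
    finally show ?thesis by (simp add: rotate_surface_def exp_add)
  qed
  ultimately show ?thesis unfolding surface_contains_def by blast
qed

lemma slit_disk_branch:
  assumes p: "asc r p x" "asc r p (x + 2 * pi)" and r: "r < 0" and a: "a \<le> exp r"
  shows "surface_contains f unit_disk (rotate_surface x id) (slit_disk a)"
proof -
  define Sl where "Sl = {v \<in> ball 0 1. \<not> (v = of_real (cmod v) * cis x \<and> exp r \<le> cmod v)}"
  obtain h where h: "h holomorphic_on Sl" "inj_on h Sl" "h ` Sl \<subseteq> ball 0 1" "\<And>v. v \<in> Sl \<Longrightarrow> f (h v) = v"
    using slit_branch[OF p r] unfolding Sl_def by blast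
  have rot: "cis x * w \<in> Sl" if w: "w \<in> slit_disk a" for w
  proof -
    have "\<not> (cis x * w = of_real (cmod w) * cis x \<and> exp r \<le> cmod w)"
    proof
      assume a': "cis x * w = of_real (cmod w) * cis x \<and> exp r \<le> cmod w"
      then have "cis x * w = cis x * of_real (cmod w)" by (simp add: mult.commute)
      then have "w = of_real (cmod w)" by simp
      moreover have "a \<le> cmod w" "cmod w < 1" using a' a w by (auto simp: slit_disk_def)
      then have "of_real (cmod w) \<in> closed_segment (complex_of_real a) (of_real 1)"
        unfolding closed_segment_of_real closed_segment_eq_real_ivl by auto
      ultimately show False using w unfolding slit_disk_def by (metis DiffD2 of_real_1)
    qed
    then show ?thesis using w by (simp add: Sl_def norm_mult slit_disk_def)
  qed
  have "(h \<circ> (\<lambda>w. cis x * w)) holomorphic_on slit_disk a"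
    by (rule holomorphic_on_compose_gen[OF _ h(1)]) (auto intro!: holomorphic_intros rot)
  then have "(\<lambda>w. h (cis x * w)) holomorphic_on slit_disk a" by (simp add: o_def)
  moreover have "inj_on (\<lambda>w. h (cis x * w)) (slit_disk a)"
  proof (rule inj_onI)
    fix u v assume "u \<in> slit_disk a" "v \<in> slit_disk a" "h (cis x * u) = h (cis x * v)"
    then have "cis x * u = cis x * v" using inj_onD[OF h(2)] rot by blast
    then show "u = v" by simp
  qed
  moreover have "(\<lambda>w. h (cis x * w)) ` slit_disk a \<subseteq> unit_disk" using h(3) rot by blast
  moreover have "f (h (cis x * w)) = rotate_surface x id w" if "w \<in> slit_disk a" for w
    using h(4)[OF rot[OF that]] by (simp add: rotate_surface_def cis_conv_exp)
  ultimately show ?thesis unfolding surface_contains_def by blast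
qed

lemma regular_strip:
  assumes p: "asc r p b" "asc r p c" "r < 0" "b < c"
  shows "\<exists>x. b \<le> x \<and> x + 2 * pi \<le> c \<and> (\<forall>w. Re w < 0 \<longrightarrow> x < Im w \<longrightarrow> Im w < x + 2 * pi \<longrightarrow> reg w)"
proof -
  obtain r' p' x y where xy: "asc r' p' x" "asc r' p' y" "b \<le> x" "x < y" "y \<le> c"
      "\<And>w. Re w < 0 \<Longrightarrow> x < Im w \<Longrightarrow> Im w < y \<Longrightarrow> reg w"
  proof -
    from minimal_pair[of UNIV r p b c, OF UNIV_I p(1-3) UNIV_I p(4)]
    obtain r' p' x y where o: "asc r' p' x" "asc r' p' y" "b \<le> x" "x < y" "y \<le> c"
      and rg: "\<forall>w. Re w \<in> UNIV \<longrightarrow> Re w < 0 \<longrightarrow> x < Im w \<longrightarrow> Im w < y \<longrightarrow> reg w"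
      by (elim exE conjE)
    have "reg w" if "Re w < 0" "x < Im w" "Im w < y" for w
      using rg[THEN spec, of w] that by simp
    with o show ?thesis by (rule that)
  qed
  obtain m :: nat where m: "0 < m" "y = x + 2 * pi * m" 
    by (rule exE[OF pair_diff[OF xy(1,2,4)]]) auto
  have "2 * pi * 1 \<le> 2 * pi * real m" using m by (intro mult_left_mono) auto
  then have "x + 2 * pi \<le> y" using m by simp
  then show ?thesis using xy(3,5,6) by (intro exI[of _ x]) simp
qed

theorem contains_one_of_three:
  assumes a: "0 < a" "a < 1"
  shows "\<exists>\<theta>. surface_contains f unit_disk (rotate_surface \<theta> id) (slit_disk a)
         \<or> surface_contains f unit_disk (rotate_surface \<theta> exp) (G_dom a)
         \<or> surface_contains f unit_disk (rotate_surface \<theta> exp) (G_dom_refl a)"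
proof -
  define L where "L = ln a"
  have L: "L < 0" "exp L = a" using a by (auto simp: L_def)
  \<comment> \<open>one ascent, read with the labels \<open>0\<close> and \<open>2 pi n\<close> of its end, is a first pair\<close>
  define p0 where "p0 = Hs 1 (Complex (L/2) 0)"
  have "asc (L/2) p0 0" unfolding p0_def using L by (intro asc_Hs) auto
  moreover from asc_shift[OF this, of 1] have "asc (L/2) p0 (2 * pi * n)" by simp
  moreover have "L/2 < 0" "L/2 \<in> {L..}" "0 < 2 * pi * n" using L n_pos by auto
  ultimately have "\<exists>r p b c. asc r p b \<and> asc r p c \<and> r < 0 \<and> r \<in> {L..} \<and> 0 \<le> b \<and> b < c \<and> c \<le> 2 * pi * n \<and>
      (\<forall>w. Re w \<in> {L..} \<longrightarrow> Re w < 0 \<longrightarrow> b < Im w \<longrightarrow> Im w < c \<longrightarrow> reg w)"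
    by (intro minimal_pair[of "{L..}" "L/2" p0 0 "2 * pi * n"]) auto
  then obtain r p b c where bc: "asc r p b" "asc r p c" "r < 0" "r \<in> {L..}" "0 \<le> b" "b < c" "c \<le> 2 * pi * n"
    and reg_all: "\<forall>w. Re w \<in> {L..} \<longrightarrow> Re w < 0 \<longrightarrow> b < Im w \<longrightarrow> Im w < c \<longrightarrow> reg w"
    by (elim exE conjE)
  have reg_bc: "reg w" if "L \<le> Re w" "Re w < 0" "b < Im w" "Im w < c" for w
    using reg_all[THEN spec, of w] that by simp
  obtain m :: nat where m: "0 < m" "c = b + 2 * pi * m"
    by (rule exE[OF pair_diff[OF bc(1,2,6)]]) auto
  show ?thesis
  proof (cases "m = 1")
    case True
    have "L \<le> r" using bc(4) by simp
    then have "a \<le> exp r" using L(2) by (metis exp_le_cancel_iff)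
    then have "surface_contains f unit_disk (rotate_surface b id) (slit_disk a)"
      using slit_disk_branch[of r p b a] bc(1-3) m True by simp
    then show ?thesis by blast
  next
    case False
    then have "2 * pi * 2 \<le> 2 * pi * real m" using m by (intro mult_left_mono) auto
    then have c4: "b + 4 * pi \<le> c" using m by simp
    with bc(5,7) have n4: "4 * pi \<le> 2 * pi * n" by linarith
    obtain x where x: "b \<le> x" "x + 2 * pi \<le> c"
        "\<And>w. Re w < 0 \<Longrightarrow> x < Im w \<Longrightarrow> Im w < x + 2 * pi \<Longrightarrow> reg w"
      using regular_strip[OF bc(1-3,6)] by blast
    show ?thesis
    proof (cases "x + 3 * pi \<le> c")
      case True
      have "surface_contains f unit_disk (rotate_surface x exp) (G_dom a)"
      proof (rule translated_branch[OF open_G_dom, of _ _ 0])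
        fix w assume w: "w \<in> G_dom a"
        show "Re w < 0" using w by (auto simp: G_dom_def)
        show "reg (w + Complex 0 x)"
          using w x reg_bc[of "w + Complex 0 x"] True by (auto simp: G_dom_def L_def)
        have "0 < Im w" "Im w < 4 * pi" using w pi_gt_zero by (auto simp: G_dom_def)
        then show "0 < Im w \<and> Im w < 0 + 2 * pi * n" using n4 by linarith
      qed
      then show ?thesis by blast
    next
      case False
      \<comment> \<open>the interval has length at least \<open>4 pi\<close>, so the lower side has room for a half turn\<close>
      have "surface_contains f unit_disk (rotate_surface (x + 2 * pi) exp) (G_dom_refl a)"
      proof (rule translated_branch[OF open_G_dom_refl, of _ _ "-4 * pi"])
        fix w assume w: "w \<in> G_dom_refl a"
        show "Re w < 0" using w by (auto simp: G_dom_refl_alt)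
        show "reg (w + Complex 0 (x + 2 * pi))"
          using w x reg_bc[of "w + Complex 0 (x + 2 * pi)"] False c4 by (auto simp: G_dom_refl_alt L_def)
        have "-4 * pi < Im w" "Im w < 0" using w pi_gt_zero by (auto simp: G_dom_refl_alt)
        then show "-4 * pi < Im w \<and> Im w < -4 * pi + 2 * pi * n" using n4 by linarith
      qed
      then show ?thesis by blast
    qed
  qed
qed

end

lemma surface_contains_compose:
  assumes "surface_contains B D f X" "g holomorphic_on Y" "inj_on g Y" "g ` Y \<subseteq> X"
    "\<And>w. w \<in> Y \<Longrightarrow> f (g w) = f' w"
  shows "surface_contains B D f' Y"
proof -
  obtain h where h: "h holomorphic_on X" "inj_on h X" "h ` X \<subseteq> D" "\<And>w. w \<in> X \<Longrightarrow> B (h w) = f w"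
    using assms(1) unfolding surface_contains_def by blast
  have "(h \<circ> g) holomorphic_on Y" by (rule holomorphic_on_compose_gen[OF assms(2) h(1) assms(4)])
  moreover have "inj_on (h \<circ> g) Y" using assms(3,4) h(2) by (meson comp_inj_on inj_on_subset)
  ultimately show ?thesis unfolding surface_contains_def
    using h(3,4) assms(4,5) by (intro exI[of _ "h \<circ> g"]) (auto simp: image_subset_iff)
qed

lemma surface_contains_subset:
  "surface_contains B D f X \<Longrightarrow> Y \<subseteq> X \<Longrightarrow> surface_contains B D f Y"
  by (rule surface_contains_compose[where g="\<lambda>w. w"]) auto

text \<open>The assertion to be proved, for an arbitrary real parameter \<open>a\<close>.\<close>

definition contains_any :: "(complex \<Rightarrow> complex) \<Rightarrow> real \<Rightarrow> bool" where
  "contains_any B a \<longleftrightarrow> (\<exists>\<theta>. surface_contains B unit_disk (rotate_surface \<theta> id) (slit_disk a)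
         \<or> surface_contains B unit_disk (rotate_surface \<theta> exp) (G_dom a)
         \<or> surface_contains B unit_disk (rotate_surface \<theta> exp) (G_dom_refl a))"

lemma slit_disk_nonneg_iff:
  assumes "0 \<le> a"
  shows "w \<in> slit_disk a \<longleftrightarrow> cmod w < 1 \<and> \<not> (Im w = 0 \<and> a \<le> Re w)"
proof -
  have "w \<in> closed_segment (complex_of_real a) 1 \<longleftrightarrow> Im w = 0 \<and> Re w \<in> closed_segment a 1"
    using closed_segment_of_real[of a 1] by (auto simp: image_iff complex_eq_iff intro!: bexI[of _ "Re w"])
  moreover have "\<bar>Re w\<bar> < 1" if "cmod w < 1" using that abs_Re_le_cmod[of w] by simp
  ultimately show ?thesis using assms
    by (auto simp: slit_disk_def closed_segment_eq_real_ivl split: if_splits)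
qed

lemma strip_exp_slit:
  assumes w: "Re w < 0" "0 < Im w" "Im w < 2 * pi" and a: "0 < a"
  shows "exp w \<in> slit_disk a"
proof -
  have "\<not> (Im (exp w) = 0 \<and> a \<le> Re (exp w))"
  proof
    assume h: "Im (exp w) = 0 \<and> a \<le> Re (exp w)"
    then have "sin (Im w) = 0" by (simp add: Im_exp)
    then have "Im w = pi" using w sin_gt_zero[of "Im w"] sin_lt_zero[of "Im w"] by (cases "Im w" pi rule: linorder_cases) auto
    then show False using h a by (simp add: Re_exp) (smt (verit) exp_gt_zero)
  qed
  then show ?thesis using a w(1) by (simp add: slit_disk_nonneg_iff)
qed

lemma exp_inj_strip:
  assumes "\<And>w. w \<in> W \<Longrightarrow> lo < Im w \<and> Im w < lo + 2 * pi"
  shows "inj_on exp W"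
proof (rule inj_onI)
  fix u v :: complex assume uv: "u \<in> W" "v \<in> W" "exp u = exp v"
  show "u = v"
    by (rule exp_complex_eqI) (use uv assms[of u] assms[of v] in auto)
qed

lemma Ln_minus_slit:
  assumes "a \<le> 0" "w \<in> slit_disk a"
  shows "w \<noteq> 0" "- w \<notin> \<real>\<^sub>\<le>\<^sub>0" "Re (Ln (- w)) < 0" "\<bar>Im (Ln (- w))\<bar> < pi"
proof -
  have nn: "\<not> (Im w = 0 \<and> 0 \<le> Re w)"
  proof
    assume h: "Im w = 0 \<and> 0 \<le> Re w"
    have "cmod w < 1" using assms(2) by (simp add: slit_disk_def)
    then have "Re w < 1" using complex_Re_le_cmod[of w] by linarith
    then have "Re w \<in> closed_segment a 1" using h assms(1) by (simp add: closed_segment_eq_real_ivl)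
    then have "of_real (Re w) \<in> closed_segment (complex_of_real a) (of_real 1)"
      unfolding closed_segment_of_real by blast
    moreover have "w = of_real (Re w)" using h by (simp add: complex_eq_iff)
    ultimately show False using assms(2) by (simp add: slit_disk_def)
  qed
  then show w0: "w \<noteq> 0" by auto
  show nr: "- w \<notin> \<real>\<^sub>\<le>\<^sub>0" using nn by (auto simp: complex_nonpos_Reals_iff)
  have "Re (Ln (- w)) = ln (cmod w)" using w0 by simp
  then show "Re (Ln (- w)) < 0" using assms(2) w0 by (simp add: slit_disk_def)
  show "\<bar>Im (Ln (- w))\<bar> < pi"
    using Im_Ln_less_pi[OF nr] mpi_less_Im_Ln[of "- w"] w0 by (simp add: abs_less_iff)
qed

text \<open>For \<open>a \<ge> 1\<close> the rectangle in \<open>G_dom a\<close> is empty, and the half-strip or its reflection is contained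
in each of the three surfaces with parameter \<open>1/2\<close>. For \<open>a \<le> 0\<close> the slit contains \<open>[0, 1)\<close>, so that
the slit disc lies in the one with parameter \<open>1/2\<close> and a branch of the logarithm maps it into the
half-strip or its reflection.\<close>

lemma contains_any_extend:
  assumes "contains_any B (1/2)" "\<not> (0 < a \<and> a < 1)"
  shows "contains_any B a"
proof -
  obtain t where t: "surface_contains B unit_disk (rotate_surface t id) (slit_disk (1/2))
         \<or> surface_contains B unit_disk (rotate_surface t exp) (G_dom (1/2))
         \<or> surface_contains B unit_disk (rotate_surface t exp) (G_dom_refl (1/2))"
    using assms(1) unfolding contains_any_def by blast
  show ?thesis
  proof (cases "a \<ge> 1")
    case True
    then have ln: "ln a \<ge> 0" by simp
    have G: "G_dom a = {w. Re w < 0 \<and> 0 < Im w \<and> Im w < 2 * pi}"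
      using ln by (auto simp: G_dom_def)
    have GR: "G_dom_refl a = {w. Re w < 0 \<and> -2 * pi < Im w \<and> Im w < 0}"
      using ln by (auto simp: G_dom_refl_alt)
    from t consider "surface_contains B unit_disk (rotate_surface t id) (slit_disk (1/2))"
      | "surface_contains B unit_disk (rotate_surface t exp) (G_dom (1/2))"
      | "surface_contains B unit_disk (rotate_surface t exp) (G_dom_refl (1/2))" by blast
    then show ?thesis
    proof cases
      case 1
      have "surface_contains B unit_disk (rotate_surface t exp) (G_dom a)"
        by (rule surface_contains_compose[OF 1, of exp])
          (use strip_exp_slit[of _ "1/2"] in \<open>auto intro!: holomorphic_intros exp_inj_strip[of _ 0] simp: G rotate_surface_def\<close>)
      then show ?thesis unfolding contains_any_def by blast
    next
      case 2
      have "surface_contains B unit_disk (rotate_surface t exp) (G_dom a)"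
        by (rule surface_contains_subset[OF 2]) (auto simp: G, simp add: G_dom_def)
      then show ?thesis unfolding contains_any_def by blast
    next
      case 3
      have "surface_contains B unit_disk (rotate_surface t exp) (G_dom_refl a)"
        by (rule surface_contains_subset[OF 3]) (auto simp: GR, simp add: G_dom_refl_alt)
      then show ?thesis unfolding contains_any_def by blast
    qed
  next
    case False
    then have a: "a \<le> 0" using assms(2) by simp
    note Lm = Ln_minus_slit[OF a]
    have hol: "(\<lambda>w. Ln (- w) + c) holomorphic_on slit_disk a" for c
      using Lm by (intro holomorphic_intros) auto
    have inj: "inj_on (\<lambda>w. Ln (- w) + c) (slit_disk a)" for c
      using Lm(1) by (auto intro!: inj_onI) (metis exp_Ln neg_equal_0_iff_equal neg_equal_iff_equal)
    have e: "exp (Ln (- w) + of_real pi * \<i>) = w" "exp (Ln (- w) - of_real pi * \<i>) = w" if "w \<in> slit_disk a" for w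
      using Lm(1)[OF that] by (simp_all add: exp_add exp_diff)
    from t consider "surface_contains B unit_disk (rotate_surface t id) (slit_disk (1/2))"
      | "surface_contains B unit_disk (rotate_surface t exp) (G_dom (1/2))"
      | "surface_contains B unit_disk (rotate_surface t exp) (G_dom_refl (1/2))" by blast
    then have "surface_contains B unit_disk (rotate_surface t id) (slit_disk a)"
    proof cases
      case 1
      show ?thesis
      proof (rule surface_contains_subset[OF 1])
        have "closed_segment (complex_of_real (1/2)) 1 \<subseteq> closed_segment (complex_of_real a) 1"
        proof -
          have "1/2 \<in> closed_segment a 1" using a by (simp add: closed_segment_eq_real_ivl)
          then have "complex_of_real (1/2) \<in> closed_segment (complex_of_real a) (of_real 1)"
            unfolding closed_segment_of_real by (rule imageI)
          then show ?thesis by (simp only: subset_closed_segment of_real_1 ends_in_segment simp_thms)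
        qed
        then show "slit_disk a \<subseteq> slit_disk (1/2)" by (auto simp: slit_disk_def)
      qed
    next
      case 2
      show ?thesis
        by (rule surface_contains_compose[OF 2 hol[of "of_real pi * \<i>"] inj])
          (use Lm(3,4) e in \<open>force simp: G_dom_def rotate_surface_def abs_less_iff\<close>)+
    next
      case 3
      show ?thesis
        by (rule surface_contains_compose[OF 3 hol[of "- of_real pi * \<i>"] inj])
          (use Lm(3,4) e in \<open>force simp: G_dom_refl_alt rotate_surface_def abs_less_iff\<close>)+
    qed
    then show ?thesis unfolding contains_any_def by blast
  qed
qed

lemma surface_contains_cong:
  "(\<And>z. z \<in> D \<Longrightarrow> B z = B' z) \<Longrightarrow> surface_contains B D f X \<longleftrightarrow> surface_contains B' D f X"
  unfolding surface_contains_def by (metis image_subset_iff)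

theorem theorem2:
  fixes B :: "complex \<Rightarrow> complex"
  assumes "finite_blaschke_product B"
  shows "\<exists>\<theta>::real.
           surface_contains B unit_disk (rotate_surface \<theta> id) (slit_disk a_const)
         \<or> surface_contains B unit_disk (rotate_surface \<theta> exp) (G_dom a_const)
         \<or> surface_contains B unit_disk (rotate_surface \<theta> exp) (G_dom_refl a_const)"
proof -
  obtain n c where n: "n \<ge> (1::nat)" and c: "\<forall>j\<in>{1..n}. cmod (c j) < 1"
    and B: "\<And>z. z \<in> unit_disk \<Longrightarrow> B z = (\<Prod>j=1..n. bfac (c j) z)"
    using assms unfolding finite_blaschke_product_def bfac_def by blast
  define P where "P = (\<lambda>z. \<Prod>j=1..n. bfac (c j) z)"
  interpret disc_map P "{z. \<forall>j\<in>{1..n}. 1 - cnj (c j) * z \<noteq> 0}" "\<lambda>t. \<Sum>j=1..n. bfac_arg (c j) t" n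
    unfolding P_def by (rule disc_map_blaschke[OF n c])
  have "contains_any P a" if "0 < a" "a < 1" for a
    using contains_one_of_three[OF that] unfolding contains_any_def by simp
  then have any: "contains_any P a_const" using contains_any_extend[of P a_const] by force
  show ?thesis
  proof -
    have "B z = P z" if "z \<in> unit_disk" for z using B[OF that] by (simp add: P_def)
    then have "surface_contains B unit_disk g X \<longleftrightarrow> surface_contains P unit_disk g X" for g X
      by (rule surface_contains_cong)
    then show ?thesis using any unfolding contains_any_def by simp
  qed
qed

end
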